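(* Let $\varphi=\frac{1+\sqrt5}{2}$ and let $(F_n)_{n\in\mathbb Z}$ be the bilateral Fibonacci sequence. For $n\in\mathbb Z$ let $D_n$ be the disk with symbol $$D_n=\frac{2F_n\varphi^n,\ 1}{2\varphi^{2n},\ 2F_n^2},$$ i.e. the disk with center $\left(F_n\varphi^{-n},\ \tfrac12\varphi^{-2n}\right)$ and radius $\tfrac12\varphi^{-2n}$. Let $L$ denote the generalized disk $\{(x,y): y\le 0\}$ bounded by the horizontal line $y=0$, whose symbol is $\frac{0,\ -1}{0,\ 0}$. Then: (1) For every $n\in\mathbb Z$, the four generalized disks $L, D_n, D_{n+1}, D_{n+2}$ form a Descartes configuration. (2) There is an Apollonian packing that contains $L$ and all the disks $D_n$, $n\in\mathbb Z$, that fills the upper half-plane, and that contains disks of arbitrarily large finite radius. (3) In particular, the three disks with symbols $$\frac{0,\ -1}{0,\ 0},\qquad \frac{0,\ 1}{2,\ 0},\qquad \frac{2\varphi,\ 1}{2\varphi^2,\ 2}$$ (that is, $L$, $D_0$, $D_1$) are a seed of this packing.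
   Context: Fibonacci numbers: $(F_n)_{n\in\mathbb Z}$ is defined by $F_0=0$, $F_1=1$, $F_{n+1}=F_n+F_{n-1}$ for all $n\in\mathbb Z$ (so $F_{-1}=1$, $F_{-2}=-1$, $F_{-3}=2$, ...). Generalized disks: a generalized disk in the plane $\mathbb R^2$ (viewed in the Riemann sphere $\mathbb R^2\cup\{\infty\}$) is an ordinary closed disk (positive curvature), a closed half-plane (curvature $0$; it contains the point $\infty$), or the closed exterior of a circle together with $\infty$ (negative radius and curvature). Symbols: the disk with center $(x,y)$, radius $r$ and curvature $\beta=1/r$ is coded by the symbol $\frac{\dot x,\ \dot y}{\beta,\ \gamma}$, where $\dot x=x/r$, $\dot y=y/r$, and the co-curvature $\gamma$ is the curvature of the image of the disk under inversion in the unit circle; it is determined by $-\dot x^2-\dot y^2+\beta\gamma=-1$ when $\beta\neq0$. The half-plane $y\le 0$ has symbol $\frac{0,\ -1}{0,\ 0}$. Tangency: two generalized disks are (externally) tangent if their interiors are disjoint and they meet in exactly one point of the sphere (two parallel disjoint half-planes are tangent at $\infty$). In terms of symbols tangency corresponds to $-\dot x_1\dot x_2-\dot y_1\dot y_2+\frac12(\beta_1\gamma_2+\gamma_1\beta_2)=1$. Four generalized disks form a Descartes configuration if they are pairwise tangent. Apollonian packing: given three mutually tangent generalized disks (called a seed), the Apollonian packing they determine is the family of generalized disks obtained by recursively inscribing new disks in the curvilinear triangles between mutually tangent disks; i.e. the smallest family containing the seed such that, whenever three pairwise tangent members are given, both generalized disks tangent to all three also belong to the family. "Fills the upper half-plane"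 means: the members of the packing have pairwise disjoint interiors, all members other than $\{y\le0\}$ are ordinary disks contained in $\{y\ge0\}$, and the union of these disks is dense in $\{y\ge 0\}$. *)

theory Defs
  imports "HOL-Analysis.Analysis"
begin

type_synonym plane = "real \<times> real"

text \<open>The sphere is the one-point compactification of the plane: \<open>Some p\<close> is a finite
  point and \<open>None\<close> is the point at infinity.\<close>

type_synonym sphere = "plane option"

abbreviation sphere_top :: "sphere topology" where
  "sphere_top \<equiv> Alexandroff_compactification euclidean"

text \<open>A negative radius \<open>r\<close> gives the closed exterior of the circle of radius \<open>- r\<close>.\<close>

definition circle_disk :: "plane \<Rightarrow> real \<Rightarrow> sphere set" where
  "circle_disk c r =
     (if r > 0 then Some ` cball c r else insert None (Some ` {p. dist c p \<ge> - r}))"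

definition half_plane :: "plane \<Rightarrow> real \<Rightarrow> sphere set" where
  "half_plane a b = insert None (Some ` {p. a \<bullet> p \<le> b})"

definition generalized_disk :: "sphere set \<Rightarrow> bool" where
  "generalized_disk D \<longleftrightarrow>
     (\<exists>c r. r \<noteq> 0 \<and> D = circle_disk c r) \<or> (\<exists>a b. norm a = 1 \<and> D = half_plane a b)"

inductive has_curvature :: "sphere set \<Rightarrow> real \<Rightarrow> bool" where
  circle: "r \<noteq> 0 \<Longrightarrow> has_curvature (circle_disk c r) (1 / r)"
| line: "norm a = 1 \<Longrightarrow> has_curvature (half_plane a b) 0"

fun inversion :: "sphere \<Rightarrow> sphere" where
  "inversion None = Some 0"
| "inversion (Some p) = (if p = 0 then None else Some (p /\<^sub>R (norm p)\<^sup>2))"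

text \<open>\<open>has_symbol D (u, v, \<beta>, \<gamma>)\<close>: the disk \<open>D\<close> has reduced centre \<open>(u, v)\<close>, curvature \<open>\<beta>\<close>
  and co-curvature \<open>\<gamma>\<close>.  For a half-plane with outer unit normal \<open>a\<close> the reduced centre is
  \<open>- a\<close>, the limit of the reduced centres of the disks of radius \<open>r\<close> inside the half-plane
  tangent to its boundary at a fixed point, as \<open>r\<close> tends to infinity.\<close>

inductive has_symbol :: "sphere set \<Rightarrow> real \<times> real \<times> real \<times> real \<Rightarrow> bool" where
  circle: "r \<noteq> 0 \<Longrightarrow> has_curvature (inversion ` circle_disk (x, y) r) \<gamma> \<Longrightarrow>
     has_symbol (circle_disk (x, y) r) (x / r, y / r, 1 / r, \<gamma>)"
| line: "norm (u, v) = 1 \<Longrightarrow> has_curvature (inversion ` half_plane (u, v) b) \<gamma> \<Longrightarrow>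
     has_symbol (half_plane (u, v) b) (- u, - v, 0, \<gamma>)"

definition tangent :: "sphere set \<Rightarrow> sphere set \<Rightarrow> bool" where
  "tangent A B \<longleftrightarrow>
     (sphere_top interior_of A) \<inter> (sphere_top interior_of B) = {} \<and> (\<exists>!p. p \<in> A \<inter> B)"

definition descartes_configuration :: "sphere set set \<Rightarrow> bool" where
  "descartes_configuration S \<longleftrightarrow>
     card S = 4 \<and> (\<forall>A\<in>S. generalized_disk A) \<and> pairwise tangent S"

definition seed :: "sphere set set \<Rightarrow> bool" where
  "seed S \<longleftrightarrow> card S = 3 \<and> (\<forall>A\<in>S. generalized_disk A) \<and> pairwise tangent S"

inductive_set packing_of :: "sphere set set \<Rightarrow> sphere set set" for S where
  seed_mem: "A \<in> S \<Longrightarrow> A \<in> packing_of S"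
| inscribe: "A \<in> packing_of S \<Longrightarrow> B \<in> packing_of S \<Longrightarrow> C \<in> packing_of S \<Longrightarrow>
     tangent A B \<Longrightarrow> tangent A C \<Longrightarrow> tangent B C \<Longrightarrow>
     generalized_disk E \<Longrightarrow> tangent E A \<Longrightarrow> tangent E B \<Longrightarrow> tangent E C \<Longrightarrow>
     E \<in> packing_of S"

definition is_seed_of :: "sphere set set \<Rightarrow> sphere set set \<Rightarrow> bool" where
  "is_seed_of S P \<longleftrightarrow> seed S \<and> P = packing_of S"

definition apollonian_packing :: "sphere set set \<Rightarrow> bool" where
  "apollonian_packing P \<longleftrightarrow> (\<exists>S. is_seed_of S P)"

definition lower_half_plane :: "sphere set" where
  "lower_half_plane = insert None (Some ` {(x, y). y \<le> 0})"

definition fills_upper_half_plane :: "sphere set set \<Rightarrow> bool" where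
  "fills_upper_half_plane P \<longleftrightarrow>
     pairwise (\<lambda>A B. (sphere_top interior_of A) \<inter> (sphere_top interior_of B) = {}) P \<and>
     (\<forall>A \<in> P - {lower_half_plane}.
        \<exists>c r. r > 0 \<and> A = circle_disk c r \<and> cball c r \<subseteq> {(x, y). y \<ge> 0}) \<and>
     {(x, y). y \<ge> 0} \<subseteq> closure {p. Some p \<in> \<Union> (P - {lower_half_plane})}"

function bifib :: "int \<Rightarrow> int" where
  "bifib n =
     (if n = 0 then 0 else if n = 1 then 1
      else if n > 1 then bifib (n - 1) + bifib (n - 2)
      else bifib (n + 2) - bifib (n + 1))"
  by auto
termination
  by (relation "Wellfounded.measure (\<lambda>n. if n \<ge> 0 then nat n else nat (1 - n))") auto

declare bifib.simps [simp del]

lemma bifib_0: "bifib 0 = 0" and bifib_1: "bifib 1 = 1"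
  by (simp_all add: bifib.simps)

lemma bifib_rec: "bifib (n + 1) = bifib n + bifib (n - 1)"
proof -
  consider "n \<ge> 1" | "n \<le> 0" by linarith
  then show ?thesis
  proof cases
    case 1
    then show ?thesis using bifib.simps[of "n + 1"] by simp
  next
    case 2
    then show ?thesis using bifib.simps[of "n - 1"] by (simp add: add.commute)
  qed
qed

definition phi :: real where
  "phi = (1 + sqrt 5) / 2"

definition fib_disk :: "int \<Rightarrow> sphere set" where
  "fib_disk n =
     circle_disk (of_int (bifib n) * phi powi (- n), phi powi (- 2 * n) / 2)
       (phi powi (- 2 * n) / 2)"

end

theory Submission
  imports Defs
begin

text \<open>Symbols are vectors of a four-dimensional Lorentzian space with form \<open>ip\<close>, normalised so that
  disks have square \<open>-1\<close> and tangency is product \<open>1\<close>. A Descartes configuration is a basis with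
  Gram matrix \<open>1 - 2 \<delta>\<close>, and replacing one disk by the other solution of the tangency problem is
  the reflection \<open>v k := 2 S - 3 v k\<close>, where \<open>S\<close> is the sum of the four vectors. The Fibonacci
  quadruples form a single orbit of such moves. Along reduced sequences of moves the products with
  a fixed member grow, so distinct members have product at least \<open>1\<close>: their interiors are disjoint,
  and every tangent triple lies in one quadruple of the orbit, hence the packing is exactly the set
  of members.

  For density, a point that no member covers lies in a curvilinear triangle, hence in the disk
  bounded by the circle through its three vertices. After inscribing a disk the point lies in one
  of the three smaller triangles, and the curvature of the circle through the vertices grows by
  the sum of two curvatures of the packing, which is bounded below, so the triangles shrink to
  the point.\<close>

section \<open>Quadruples under the Apollonian moves\<close>

text \<open>Polymorphic because the same move acts on quadruples of symbols and, by linearity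
  (\<open>reflect_ip\<close>), on the real tuples of their products with a fixed vector.\<close>

definition reflect :: "4 \<Rightarrow> (4 \<Rightarrow> 'a) \<Rightarrow> 4 \<Rightarrow> 'a::real_vector" where
  "reflect k v = v(k := 2 *\<^sub>R sum v UNIV - 3 *\<^sub>R v k)"

section \<open>Bookkeeping for the four positions of a quadruple\<close>

lemma card_four_indices: "card {i, j, k, l} = 4 \<Longrightarrow> {i, j, k, l} = (UNIV :: 4 set)"
  by (rule card_subset_eq) auto

lemma sum_distinct_indices:
  fixes f :: "4 \<Rightarrow> 'a::comm_monoid_add"
  assumes "distinct [i, j, k, l]"
  shows "sum f UNIV = f i + f j + f k + f l"
proof -
  have "card {i, j, k, l} = 4" using assms by simp
  then have "sum f UNIV = sum f {i, j, k, l}" using card_four_indices[of i j k l] by simp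
  also have "\<dots> = f i + f j + f k + f l" using assms by (simp add: add.assoc)
  finally show ?thesis .
qed

lemma all_distinct_indices:
  fixes i :: 4
  assumes "distinct [i, j, k, l]"
  shows "(\<forall>m. P m) \<longleftrightarrow> P i \<and> P j \<and> P k \<and> P l"
proof -
  have "card {i, j, k, l} = 4" using assms by simp
  then have "\<And>m. m = i \<or> m = j \<or> m = k \<or> m = l" using card_four_indices[of i j k l] by auto
  then show ?thesis by metis
qed

lemma range_distinct_indices:
  fixes v :: "4 \<Rightarrow> 'a"
  assumes "distinct [i, j, k, l]"
  shows "range v = {v i, v j, v k, v l}"
proof -
  have "card {i, j, k, l} = 4" using assms by simp
  then have "range v = v ` {i, j, k, l}" using card_four_indices[of i j k l] by simp
  then show ?thesis by simp
qed

lemma extend_indices: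
  assumes "card A < 4"
  shows "\<exists>l::4. l \<notin> A"
proof (rule ccontr)
  assume "\<not> ?thesis"
  then have "A = UNIV" by auto
  with assms show False by simp
qed

lemma obtain_fourth_index:
  fixes i j k :: 4
  assumes "distinct [i, j, k]"
  obtains l where "distinct [i, j, k, l]"
proof -
  have "card {i, j, k} < 4" using assms by simp
  from extend_indices[OF this] obtain l where "l \<notin> {i, j, k}" by blast
  with assms show thesis by (intro that[of l]) auto
qed

lemma obtain_two_indices:
  fixes i j :: 4
  assumes "i \<noteq> j"
  obtains k l where "distinct [i, j, k, l]"
proof -
  have "card {i, j} < 4" using assms by simp
  from extend_indices[OF this] obtain k where "k \<notin> {i, j}" by blast
  then have "distinct [i, j, k]" using assms by auto
  then show thesis using obtain_fourth_index that by metis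
qed

lemma obtain_three_indices:
  fixes i :: 4
  obtains j k l where "distinct [i, j, k, l]"
proof -
  have "card {i} < 4" by simp
  from extend_indices[OF this] obtain j where "j \<notin> {i}" by blast
  then have "i \<noteq> j" by simp
  then show thesis using obtain_two_indices that by metis
qed

lemma reflect_other [simp]: "i \<noteq> k \<Longrightarrow> reflect k v i = v i"
  by (simp add: reflect_def)

text \<open>Turns small numeral scalars into repeated sums, so that identities in a
  \<open>real_vector\<close> reduce to commutative group arithmetic.\<close>

lemma scaleR_small_numerals: "2 *\<^sub>R x = x + x" "3 *\<^sub>R x = x + x + x" "4 *\<^sub>R x = x + x + x + x"
  for x :: "'a::real_vector"
proof -
  have "(1 + 1 + 1) *\<^sub>R x = x + x + x" "(1 + 1 + 1 + 1) *\<^sub>R x = x + x + x + x"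
    unfolding scaleR_left_distrib by simp_all
  then show "2 *\<^sub>R x = x + x" "3 *\<^sub>R x = x + x + x" "4 *\<^sub>R x = x + x + x + x"
    by (simp_all add: scaleR_2)
qed

lemma sum_reflect: "sum (reflect k v) UNIV = 3 *\<^sub>R sum v UNIV - 4 *\<^sub>R v k"
proof -
  have "sum (reflect k v) UNIV = reflect k v k + sum (reflect k v) (UNIV - {k})"
    by (rule sum.remove) auto
  also have "sum (reflect k v) (UNIV - {k}) = sum v UNIV - v k"
    by (simp add: sum.remove[of UNIV k v])
  finally show ?thesis
    by (simp add: reflect_def scaleR_small_numerals algebra_simps)
qed

lemma reflect_reflect [simp]: "reflect k (reflect k v) = v"
proof
  fix i
  show "reflect k (reflect k v) i = v i"
  proof (cases "i = k")
    case True
    have "reflect k (reflect k v) k = 2 *\<^sub>R (3 *\<^sub>R sum v UNIV - 4 *\<^sub>R v k) - 3 *\<^sub>R (2 *\<^sub>R sum v UNIV - 3 *\<^sub>R v k)"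
      by (subst reflect_def) (simp add: sum_reflect, simp add: reflect_def)
    then show ?thesis
      using True by (simp add: scaleR_small_numerals algebra_simps)
  qed simp
qed

text \<open>Linear form of Descartes' theorem: the two disks tangent to the same three add up to
  twice the sum of those three.\<close>

lemma reflect_same:
  assumes "distinct [k, i, j, l]"
  shows "reflect k v k = 2 *\<^sub>R (v i + v j + v l) - v k"
proof -
  have "reflect k v k = 2 *\<^sub>R (v i + v j + v l) + (2 *\<^sub>R v k - 3 *\<^sub>R v k)"
    unfolding reflect_def sum_distinct_indices[OF assms] by (simp add: algebra_simps)
  also have "2 *\<^sub>R v k - 3 *\<^sub>R v k = - v k"
    by (simp add: scaleR_small_numerals)
  finally show ?thesis by simp
qed

section \<open>Tuples of products and their behaviour under moves\<close>

definition unit_tuple :: "4 \<Rightarrow> 4 \<Rightarrow> real" where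
  "unit_tuple j i = (if i = j then -1 else 1)"

lemma sum_unit_tuple: "sum (unit_tuple j) UNIV = 2"
proof -
  obtain k l m where d: "distinct [j, k, l, m]" by (rule obtain_three_indices)
  show ?thesis using d by (auto simp add: sum_distinct_indices[OF d] unit_tuple_def)
qed

text \<open>The entries add up to 2, so a move fixes an entry 1 (4 - 3 = 1) and sends the entry -1
  to 4 + 3 = 7, the product of the two disks that complete the same triple.\<close>

lemma reflect_unit_tuple:
  "reflect k (unit_tuple j) = (if k = j then (unit_tuple j)(j := 7) else unit_tuple j)"
  by (auto simp: reflect_def sum_unit_tuple fun_eq_iff) (auto simp: unit_tuple_def)

text \<open>The tuples of products of one fixed vector with the members of the various quadruples.
  A reduced sequence of moves keeps raising the largest entry, so the moves can be undone one
  by one by reflecting at the unique maximum.\<close>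

inductive reduced :: "(4 \<Rightarrow> real) \<Rightarrow> bool" where
  unit: "reduced (unit_tuple j)"
| raise: "reduced x \<Longrightarrow> (\<And>i. i \<noteq> k \<Longrightarrow> 1 \<le> x i) \<Longrightarrow>
     (\<And>i. i \<noteq> k \<Longrightarrow> x i < reflect k x k) \<Longrightarrow> reduced (reflect k x)"

text \<open>A move at the place \<open>m\<close> of the last one undoes it. At another place
  \<open>k\<close> the new entry is 2 (x m + x l + x n) - x k, which exceeds x m because x k < x m,
  and x m was the strict maximum.\<close>

lemma reduced_reflect:
  assumes "reduced x"
  shows "reduced (reflect k x)"
  using assms
proof cases
  case (unit j)
  show ?thesis
  proof (cases "k = j")
    case True
    show ?thesis unfolding unit
      by (rule raise[OF reduced.unit]) (auto simp: True reflect_unit_tuple, auto simp: unit_tuple_def)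
  qed (use assms unit in \<open>simp add: reflect_unit_tuple\<close>)
next
  case (raise y m)
  show ?thesis
  proof (cases "k = m")
    case False
    then obtain l n where d: "distinct [k, m, l, n]" using obtain_two_indices by metis
    have l: "x l \<ge> 1" "x l < x m" and n: "x n \<ge> 1" "x n < x m" and k: "x k \<ge> 1" "x k < x m"
      using raise d by auto
    have "x i < reflect k x k" if "i \<noteq> k" for i
    proof -
      have "i = m \<or> i = l \<or> i = n" using that all_distinct_indices[OF d, of "\<lambda>i. i \<noteq> k \<longrightarrow> i = m \<or> i = l \<or> i = n"] by auto
      then show ?thesis using l n k by (auto simp: reflect_same[OF d])
    qed
    moreover have "1 \<le> x i" if "i \<noteq> k" for i
      using that all_distinct_indices[OF d, of "\<lambda>i. 1 \<le> x i"] l n k by auto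
    ultimately show ?thesis using assms by (intro reduced.raise) auto
  qed (use raise in simp)
qed

lemma reduced_ge_one:
  assumes "reduced x"
  shows "(\<exists>j. x = unit_tuple j) \<or> (\<forall>i. 1 \<le> x i)"
  using assms
proof cases
  case (raise y k)
  obtain i where "i \<noteq> k" by (metis obtain_three_indices distinct.simps(2) list.set_intros(1))
  then have "1 \<le> y i" "y i < x k" using raise by auto
  moreover have "x j = y j" if "j \<noteq> k" for j using that raise by simp
  ultimately show ?thesis using raise by (metis order.strict_implies_order order_trans)
qed blast

section \<open>The Lorentz product of symbols\<close>

type_synonym symbol = "real \<times> real \<times> real \<times> real"

fun ip :: "symbol \<Rightarrow> symbol \<Rightarrow> real" where
  "ip (u, v, b, g) (u', v', b', g') = - u * u' - v * v' + (b * g' + g * b') / 2"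

fun curv :: "symbol \<Rightarrow> real" where "curv (u, v, b, g) = b"

lemma ip_commute: "ip u v = ip v u"
  by (cases u; cases v) (simp add: algebra_simps)

lemma linear_ip: "linear (\<lambda>u. ip u w)"
proof (rule linearI)
  show "ip (u + v) w = ip u w + ip v w" for u v
    by (cases u; cases v; cases w) (simp add: algebra_simps add_divide_distrib)
  show "ip (c *\<^sub>R u) w = c *\<^sub>R ip u w" for c u
    by (cases u; cases w) (simp add: algebra_simps)
qed

lemma linear_curv: "linear curv"
  by (rule linearI) auto

lemmas ip_linear [simp] = linear_add[OF linear_ip] linear_diff[OF linear_ip]
  linear_cmul[OF linear_ip] linear_sum[OF linear_ip] linear_0[OF linear_ip]

lemma ip_linear_right [simp]:
  "ip w (u + v) = ip w u + ip w v" "ip w (u - v) = ip w u - ip w v"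
  "ip w (c *\<^sub>R u) = c * ip w u" "ip w (\<Sum>i\<in>A. f i) = (\<Sum>i\<in>A. ip w (f i))"
  by (simp_all add: ip_commute[of w])

lemma reflect_ip: "(\<lambda>i. ip (reflect k v i) u) = reflect k (\<lambda>i. ip (v i) u)"
  by (auto simp: reflect_def fun_eq_iff)

section \<open>Descartes quadruples as bases\<close>

definition descartes :: "(4 \<Rightarrow> symbol) \<Rightarrow> bool" where
  "descartes v \<longleftrightarrow> (\<forall>i j. ip (v i) (v j) = unit_tuple j i) \<and>
     (\<forall>u. (\<forall>i. ip (v i) u = 0) \<longrightarrow> u = 0)"

lemma descartesD:
  assumes "descartes v"
  shows "ip (v i) (v j) = (if i = j then -1 else 1)" "(\<forall>i. ip (v i) u = 0) \<Longrightarrow> u = 0"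
  using assms unfolding descartes_def unit_tuple_def by metis+

text \<open>The nondegeneracy clause of \<open>descartes\<close> in working form: symbols are
  identified through their four products, without coordinates.\<close>

lemma descartes_eqI:
  assumes "descartes v" "\<And>i. ip (v i) u = ip (v i) w"
  shows "u = w"
proof -
  have "u - w = 0"
    by (rule descartesD(2)[OF assms(1)]) (use assms(2) in simp)
  then show ?thesis by simp
qed

lemma descartes_sum_ip:
  assumes "descartes v"
  shows "ip (sum v UNIV) (v j) = 2"
  using sum_unit_tuple[of j] by (simp add: descartesD(1)[OF assms] unit_tuple_def)

text \<open>Nondegeneracy survives because reflecting the tuple of products again recovers the old
  one. With S the sum, S has product 2 with each member and 8 with itself, so 2 S - 3 v k has
  product 4 - 3 = 1 with the others and square 32 - 24 - 9 = -1.\<close>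

lemma descartes_reflect:
  assumes "descartes v"
  shows "descartes (reflect k v)"
  unfolding descartes_def
proof (intro conjI allI impI)
  fix u assume *: "\<forall>i. ip (reflect k v i) u = 0"
  have "ip (v i) u = 0" for i
  proof -
    have "(\<lambda>i. ip (v i) u) = reflect k (\<lambda>i. ip (reflect k v i) u)"
      by (simp add: reflect_ip)
    also have "\<dots> = (\<lambda>i. 0)" using * by (auto simp: reflect_def)
    finally show ?thesis by meson
  qed
  then show "u = 0" by (rule descartesD(2)[OF assms, OF allI])
next
  fix i j
  have s: "ip (sum v UNIV) (v j) = 2" "ip (v j) (sum v UNIV) = 2" for j
    by (rule descartes_sum_ip[OF assms], subst ip_commute, rule descartes_sum_ip[OF assms])
  have ss: "ip (sum v UNIV) (sum v UNIV) = 8"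
    using s by (subst linear_sum[OF linear_ip]) (simp del: ip_linear_right)
  show "ip (reflect k v i) (reflect k v j) = unit_tuple j i"
    by (auto simp: reflect_def unit_tuple_def s ss descartesD[OF assms] simp del: ip_linear(4) ip_linear_right(4))
qed

lemma descartes_inj:
  assumes "descartes v"
  shows "inj v"
proof (rule injI)
  fix i j assume "v i = v j"
  then show "i = j" using descartesD(1)[OF assms, of i j] descartesD(1)[OF assms, of i i] by (auto split: if_splits)
qed

text \<open>With J the all-ones matrix, the Gram matrix J - 2 I has inverse J / 4 - I / 2, since J^2
  = 4 J; this gives the coefficients.\<close>

lemma descartes_expand:
  assumes "descartes v"
  defines "x u i \<equiv> ip (v i) u"
  shows "u = (\<Sum>i\<in>UNIV. (sum (x u) UNIV / 4 - x u i / 2) *\<^sub>R v i)"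
proof (rule descartes_eqI[OF assms(1)])
  fix j :: 4
  obtain k l m where d: "distinct [j, k, l, m]" by (rule obtain_three_indices)
  show "ip (v j) u = ip (v j) (\<Sum>i\<in>UNIV. (sum (x u) UNIV / 4 - x u i / 2) *\<^sub>R v i)"
    using d by (simp add: sum_distinct_indices[OF d] descartesD(1)[OF assms(1)] x_def field_simps)
qed

text \<open>Polarised form of Descartes' circle theorem. Taking \<open>u = w\<close> gives the
  quadratic relations used for tangent disks and for points.\<close>

lemma descartes_ip:
  assumes "descartes v"
  shows "4 * ip u w = (\<Sum>i\<in>UNIV. ip (v i) u) * (\<Sum>i\<in>UNIV. ip (v i) w)
           - 2 * (\<Sum>i\<in>UNIV. ip (v i) u * ip (v i) w)"
proof -
  define s where "s = (\<Sum>i\<in>UNIV. ip (v i) u)"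
  have "ip u w = (\<Sum>i\<in>UNIV. (s / 4 - ip (v i) u / 2) * ip (v i) w)"
    by (subst descartes_expand[OF assms, of u]) (simp add: s_def)
  also have "\<dots> = s / 4 * (\<Sum>i\<in>UNIV. ip (v i) w) - (\<Sum>i\<in>UNIV. ip (v i) u * ip (v i) w) / 2"
    by (simp add: left_diff_distrib sum_subtractf sum_distrib_left sum_divide_distrib)
  finally show ?thesis by (simp add: s_def)
qed

section \<open>The orbit of the Fibonacci quadruples\<close>

definition half_plane_symbol :: symbol where
  "half_plane_symbol = (0, -1, 0, 0)"

definition fib_symbol :: "int \<Rightarrow> symbol" where
  "fib_symbol n = (2 * of_int (bifib n) * phi powi n, 1, 2 * phi powi (2 * n), 2 * (of_int (bifib n))\<^sup>2)"

lemma phi_pos: "phi > 0" and phi_gt_1: "phi > 1" and phi_square: "phi\<^sup>2 = phi + 1"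
proof -
  show "phi > 0" by (simp add: phi_def add_pos_nonneg)
  have "sqrt 5 > 1" by simp
  then show "phi > 1" by (simp add: phi_def)
  show "phi\<^sup>2 = phi + 1" by (simp add: phi_def power2_eq_square field_simps)
qed

lemma fib_symbol_0: "fib_symbol 0 = (0, 1, 2, 0)"
  and fib_symbol_1: "fib_symbol 1 = (2 * phi, 1, 2 * phi\<^sup>2, 2)"
  and fib_symbol_2: "fib_symbol 2 = (2 * phi\<^sup>2, 1, 2 * phi ^ 4, 2)"
proof -
  have "bifib 2 = 1" using bifib_rec[of 1] by (simp add: bifib_0 bifib_1)
  then show "fib_symbol 2 = (2 * phi\<^sup>2, 1, 2 * phi ^ 4, 2)"
    by (simp add: fib_symbol_def power_int_def)
qed (simp_all add: fib_symbol_def bifib_0 bifib_1 power_int_def)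

text \<open>Both D_n and D_(n+3) complete the triple formed by the line, D_(n+1) and D_(n+2). In
  terms of phi^n, F_n and F_(n+1) this is a polynomial identity modulo phi^2 = phi + 1.\<close>

lemma fib_symbol_rec:
  "fib_symbol (n + 3) = 2 *\<^sub>R (half_plane_symbol + fib_symbol (n + 1) + fib_symbol (n + 2)) - fib_symbol n"
proof -
  define t where "t = phi powi n"
  define a where "a = (of_int (bifib n) :: real)"
  define b where "b = (of_int (bifib (n + 1)) :: real)"
  have t: "phi powi (n + 1) = t * phi" "phi powi (n + 2) = t * phi\<^sup>2" "phi powi (n + 3) = t * phi ^ 3"
    using phi_pos by (simp_all add: t_def power_int_add)
  have f: "bifib (n + 2) = bifib (n + 1) + bifib n" "bifib (n + 3) = 2 * bifib (n + 1) + bifib n"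
  proof -
    have "n + 1 + 1 = n + 2" "n + 2 + 1 = n + 3" "n + 2 - 1 = n + 1" by simp_all
    with bifib_rec[of "n + 1"] bifib_rec[of "n + 2"]
    show "bifib (n + 2) = bifib (n + 1) + bifib n" "bifib (n + 3) = 2 * bifib (n + 1) + bifib n"
      by simp_all
  qed
  have sq: "phi powi (2 * m) = (phi powi m)\<^sup>2" for m
    by (simp add: power_int_mult mult.commute[of 2])
  have p3: "phi ^ 3 = 2 * phi + 1"
    using phi_square by (simp add: power3_eq_cube power2_eq_square algebra_simps)
  show ?thesis
    unfolding fib_symbol_def half_plane_symbol_def sq t f phi_square p3
    by (simp add: power2_eq_square algebra_simps flip: t_def a_def b_def)
qed


definition base_quad :: "4 \<Rightarrow> symbol" where
  "base_quad i = (if i = 0 then half_plane_symbol else if i = 1 then fib_symbol 0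
                  else if i = 2 then fib_symbol 1 else fib_symbol 2)"

definition quads :: "(4 \<Rightarrow> symbol) set" where
  "quads = {v. (\<lambda>v w. \<exists>k. w = reflect k v)\<^sup>*\<^sup>* base_quad v}"

definition members :: "symbol set" where
  "members = (\<Union>v\<in>quads. range v)"

lemma base_quad_in_quads: "base_quad \<in> quads"
  by (simp add: quads_def)

lemma reflect_in_quads: "v \<in> quads \<Longrightarrow> reflect k v \<in> quads"
  unfolding quads_def by (auto intro: rtranclp.rtrancl_into_rtrancl)

lemma quads_induct [consumes 1, case_names base reflect]:
  assumes "v \<in> quads" "P base_quad" "\<And>v k. v \<in> quads \<Longrightarrow> P v \<Longrightarrow> P (reflect k v)"
  shows "P v"
  using assms(1) unfolding quads_def mem_Collect_eq
proof (induction rule: rtranclp_induct)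
  case (step v w)
  then show ?case using assms(3) unfolding quads_def by auto
qed (rule assms)

text \<open>Moves are involutions, so any quadruple of the orbit can serve as the starting
  point.\<close>

lemma quads_connected:
  assumes "v \<in> quads" "w \<in> quads"
  shows "(\<lambda>v w. \<exists>k. w = reflect k v)\<^sup>*\<^sup>* v w"
proof -
  have "symp (\<lambda>v w :: 4 \<Rightarrow> symbol. \<exists>k. w = reflect k v)"
    by (rule sympI) (metis reflect_reflect)
  then have "(\<lambda>v w. \<exists>k. w = reflect k v)\<^sup>*\<^sup>* v base_quad"
    using assms(1) by (auto simp: quads_def intro: sympD[OF symp_rtranclp])
  also have "(\<lambda>v w. \<exists>k. w = reflect k v)\<^sup>*\<^sup>* base_quad w"
    using assms(2) by (simp add: quads_def)
  finally show ?thesis .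
qed

lemma distinct_base_indices: "distinct [0, 1, 2, 3 :: 4]"
  by simp

lemma descartes_base_quad: "descartes base_quad"
  unfolding descartes_def
proof (intro conjI allI impI)
  have pp: "phi * phi = phi + 1" using phi_square by (simp add: power2_eq_square)
  then have p2: "phi * phi = phi + 1" "phi * (phi * x) = phi * x + x" for x
    by (simp_all flip: mult.assoc) (simp add: algebra_simps)
  then have "phi ^ 4 = 3 * phi + 2"
    by (simp add: eval_nat_numeral algebra_simps)
  then have b: "base_quad 0 = (0, -1, 0, 0)" "base_quad 1 = (0, 1, 2, 0)"
    "base_quad 2 = (2 * phi, 1, 2 * phi + 2, 2)" "base_quad 3 = (2 * phi + 2, 1, 6 * phi + 4, 2)"
    by (simp_all add: base_quad_def half_plane_symbol_def fib_symbol_0 fib_symbol_1 fib_symbol_2 phi_square)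
  fix i j
  have "\<forall>i j. ip (base_quad i) (base_quad j) = unit_tuple j i"
    unfolding all_distinct_indices[OF distinct_base_indices] b
    by (simp add: unit_tuple_def algebra_simps p2)
  then show "ip (base_quad i) (base_quad j) = unit_tuple j i" by blast
  fix u assume *: "\<forall>i. ip (base_quad i) u = 0"
  obtain p q r s where u: "u = (p, q, r, s)" by (cases u)
  \<comment> \<open>The line and D_0 eliminate \<open>q\<close> and \<open>s\<close>; D_1 and D_2
    then give two proportionality relations between \<open>r\<close> and \<open>p\<close> with
    different factors.\<close>
  have "q = 0" "s = 0" using *[rule_format, of 0] *[rule_format, of 1] by (simp_all add: b u)
  moreover have "r = 2 * (phi + 1) * p"
    using *[rule_format, of 3] \<open>q = 0\<close> \<open>s = 0\<close> by (auto simp: b u algebra_simps)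
  moreover have "r = 2 * phi * p"
    using *[rule_format, of 2] \<open>q = 0\<close> \<open>s = 0\<close> by (simp add: b u)
  ultimately show "u = 0" by (simp add: u zero_prod_def algebra_simps)
qed

lemma descartes_quads: "v \<in> quads \<Longrightarrow> descartes v"
  by (induction rule: quads_induct) (auto simp: descartes_base_quad descartes_reflect)

section \<open>Products between members of the orbit\<close>

lemma reduced_ip_quads:
  assumes "v \<in> quads" "u \<in> members"
  shows "reduced (\<lambda>i. ip (v i) u)"
proof -
  obtain w j where w: "w \<in> quads" "u = w j" using assms(2) by (auto simp: members_def)
  \<comment> \<open>Starting from a quadruple that contains \<open>u\<close>, where the tuple is a
    \<open>unit_tuple\<close>, every move acts on the tuple by \<open>reflect\<close>.\<close>
  from quads_connected[OF w(1) assms(1)] show ?thesis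
  proof (induction rule: rtranclp_induct)
    case base
    have "(\<lambda>i. ip (w i) u) = unit_tuple j"
      using descartes_quads[OF w(1)] by (auto simp: w descartes_def)
    then show ?case using reduced.unit by simp
  next
    case (step v v')
    then show ?case using reduced_reflect by (auto simp: reflect_ip)
  qed
qed

lemma ip_unit_tuple_imp_eq:
  assumes "v \<in> quads" "(\<lambda>i. ip (v i) u) = unit_tuple j"
  shows "u = v j"
proof (rule descartes_eqI[OF descartes_quads[OF assms(1)]])
  fix i
  show "ip (v i) u = ip (v i) (v j)"
    using fun_cong[OF assms(2), of i] descartesD(1)[OF descartes_quads[OF assms(1)], of i j]
    by (simp add: unit_tuple_def)
qed

lemma members_ip_self: "u \<in> members \<Longrightarrow> ip u u = -1"
  using descartesD(1)[OF descartes_quads] by (auto simp: members_def)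

text \<open>The separation of distinct members: in a reduced tuple only the -1 of a
  \<open>unit_tuple\<close> is below 1, and that entry belongs to the member itself.\<close>

lemma members_ip_ge_one:
  assumes "u \<in> members" "w \<in> members" "u \<noteq> w"
  shows "ip u w \<ge> 1"
proof -
  obtain v i where v: "v \<in> quads" "u = v i" using assms(1) by (auto simp: members_def)
  from reduced_ge_one[OF reduced_ip_quads[OF v(1) assms(2)]] show ?thesis
  proof
    assume "\<exists>j. (\<lambda>i. ip (v i) w) = unit_tuple j"
    then obtain j where j: "(\<lambda>i. ip (v i) w) = unit_tuple j" by blast
    then have "w = v j" by (rule ip_unit_tuple_imp_eq[OF v(1)])
    then have "i \<noteq> j" using assms(3) v by auto
    then show ?thesis using fun_cong[OF j, of i] v by (simp add: unit_tuple_def)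
  qed (simp add: v)
qed

text \<open>Moving the quadruple towards \<open>u\<close> undoes the maximal products, hence never touches a
  member that is already tangent to \<open>u\<close>.\<close>

lemma quads_through:
  assumes "reduced x" "v \<in> quads" "x = (\<lambda>i. ip (v i) u)" "\<And>j. j \<in> J \<Longrightarrow> x j = 1"
  shows "\<exists>w\<in>quads. (\<forall>j\<in>J. w j = v j) \<and> u \<in> range w"
  using assms
proof (induction arbitrary: v rule: reduced.induct)
  case (unit j)
  then have "u = v j" using ip_unit_tuple_imp_eq by metis
  then show ?case using unit by blast
next
  case (raise x k)
  have k: "k \<notin> J"
  proof
    assume "k \<in> J"
    then have "reflect k x k = 1" using raise.prems by blast
    moreover obtain i where "i \<noteq> k" by (metis obtain_three_indices distinct.simps(2) list.set_intros(1))
    ultimately show False using raise.hyps(2)[of i] raise.hyps(3)[of i] by simp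
  qed
  have "x = (\<lambda>i. ip (reflect k v i) u)"
    unfolding reflect_ip raise.prems(2)[symmetric] by simp
  moreover have "x j = 1" if "j \<in> J" for j
    using raise.prems(3)[OF that] that k by (metis reflect_other)
  ultimately obtain w where "w \<in> quads" "\<forall>j\<in>J. w j = reflect k v j" "u \<in> range w"
    using raise.IH[OF reflect_in_quads[OF raise.prems(1)]] by blast
  then show ?case using k by (metis reflect_other)
qed

text \<open>\<open>quads_through\<close> is applied twice: first \<open>b\<close> is brought in
  while \<open>a\<close> stays, then \<open>c\<close> while \<open>a\<close> and \<open>b\<close>
  stay.\<close>

lemma tangent_triple_in_quad:
  assumes "a \<in> members" "b \<in> members" "c \<in> members" "ip a b = 1" "ip a c = 1" "ip b c = 1"
  obtains v i j k l where "v \<in> quads" "distinct [i, j, k, l]" "v i = a" "v j = b" "v k = c"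
proof -
  obtain u i where u: "u \<in> quads" "u i = a" using assms(1) by (auto simp: members_def)
  obtain w where w: "w \<in> quads" "w i = a" "b \<in> range w"
    using quads_through[OF reduced_ip_quads[OF u(1) assms(2)] u(1) refl, of "{i}"] u assms(4) by auto
  then obtain j where j: "w j = b" by blast
  obtain v where v: "v \<in> quads" "v i = a" "v j = b" "c \<in> range v"
    using quads_through[OF reduced_ip_quads[OF w(1) assms(3)] w(1) refl, of "{i, j}"] w j assms(5,6) by auto
  then obtain k where k: "v k = c" by blast
  have "a \<noteq> b" "a \<noteq> c" "b \<noteq> c" using assms members_ip_self by fastforce+
  then have "distinct [i, j, k]" using v k by auto
  then obtain l where "distinct [i, j, k, l]" by (rule obtain_fourth_index)
  then show thesis using that v k by blast
qed

lemma tangent_to_triple_in_members: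
  assumes "v \<in> quads" "distinct [i, j, k, l]" "ip e e = -1"
    and "ip (v i) e = 1" "ip (v j) e = 1" "ip (v k) e = 1"
  shows "e \<in> members"
proof -
  define t where "t = ip (v l) e"
  \<comment> \<open>Descartes' theorem for \<open>e\<close> reads -4 = (t + 3)^2 - 2 (t^2 + 3). The
    root -1 is the fourth member of the quadruple, the root 7 its reflection.\<close>
  have "(t + 1) * (t - 7) = 0"
    using descartes_ip[OF descartes_quads[OF assms(1)], of e e] assms
    by (simp add: sum_distinct_indices[OF assms(2)] t_def algebra_simps)
  moreover have "e \<in> members" if "t = -1"
  proof -
    have "e = v l"
      by (rule ip_unit_tuple_imp_eq[OF assms(1)], rule ext, rule spec)
        (use assms that in \<open>auto simp: all_distinct_indices[OF assms(2)] t_def unit_tuple_def\<close>)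
    then show ?thesis using assms(1) by (auto simp: members_def)
  qed
  moreover have "e \<in> members" if "t = 7"
  proof -
    have "reflect l (\<lambda>i. ip (v i) e) = unit_tuple l"
      by (rule ext, rule spec)
        (use assms that in \<open>auto simp: all_distinct_indices[OF assms(2)] t_def unit_tuple_def
            reflect_def sum_distinct_indices[OF assms(2)]\<close>)
    then have "e = reflect l v l"
      by (intro ip_unit_tuple_imp_eq[OF reflect_in_quads[OF assms(1)]]) (simp add: reflect_ip)
    then show ?thesis using reflect_in_quads[OF assms(1)] by (auto simp: members_def)
  qed
  ultimately show ?thesis by auto
qed

text \<open>By \<open>fib_symbol_rec\<close> one move trades D_n for D_(n+3) and one trades D_(n+2)
  for D_(n-1), so the window slides both ways. The positions permute on the way, hence the
  quantified indices.\<close>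

lemma fib_quad:
  "\<exists>v\<in>quads. \<exists>i j k l. distinct [i, j, k, l] \<and> v i = half_plane_symbol \<and> v j = fib_symbol n \<and>
     v k = fib_symbol (n + 1) \<and> v l = fib_symbol (n + 2)" (is "?P n")
proof (induction n rule: int_induct[where k = 0])
  case base
  show ?case
    by (rule bexI[OF _ base_quad_in_quads], rule exI[of _ 0], rule exI[of _ 1], rule exI[of _ 2], rule exI[of _ 3])
      (simp add: base_quad_def)
next
  case (step1 n)
  then obtain v i j k l where v: "v \<in> quads" and d: "distinct [i, j, k, l]" and
    e: "v i = half_plane_symbol" "v j = fib_symbol n" "v k = fib_symbol (n + 1)" "v l = fib_symbol (n + 2)"
    by blast
  have "reflect j v j = fib_symbol (n + 3)"
    using d by (subst reflect_same[of j i k l]) (auto simp: e fib_symbol_rec)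
  then have "distinct [i, k, l, j] \<and> reflect j v i = half_plane_symbol \<and>
      reflect j v k = fib_symbol (n + 1) \<and> reflect j v l = fib_symbol (n + 1 + 1) \<and>
      reflect j v j = fib_symbol (n + 1 + 2)"
    using d e by (auto simp: algebra_simps)
  then show ?case using reflect_in_quads[OF v] by blast
next
  case (step2 n)
  then obtain v i j k l where v: "v \<in> quads" and d: "distinct [i, j, k, l]" and
    e: "v i = half_plane_symbol" "v j = fib_symbol n" "v k = fib_symbol (n + 1)" "v l = fib_symbol (n + 2)"
    by blast
  have "n - 1 + 3 = n + 2" "n - 1 + 1 = n" "n - 1 + 2 = n + 1" by simp_all
  with fib_symbol_rec[of "n - 1"] have "reflect l v l = fib_symbol (n - 1)"
    using d by (subst reflect_same[of l i j k]) (auto simp: e)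
  then have "distinct [i, l, j, k] \<and> reflect l v i = half_plane_symbol \<and>
      reflect l v l = fib_symbol (n - 1) \<and> reflect l v j = fib_symbol (n - 1 + 1) \<and>
      reflect l v k = fib_symbol (n - 1 + 2)"
    using d e by (auto simp: algebra_simps)
  then show ?case using reflect_in_quads[OF v] by blast
qed


lemma quads_subset_members: "v \<in> quads \<Longrightarrow> v i \<in> members"
  by (auto simp: members_def)

lemma half_plane_symbol_in_members: "half_plane_symbol \<in> members"
  and fib_symbol_in_members: "fib_symbol n \<in> members"
  using fib_quad[of n] quads_subset_members by metis+

text \<open>The product with \<open>fib_symbol 0\<close> bounds the co-curvature from below, which excludes negative
  curvature; half-planes are excluded by the large disks \<open>fib_symbol n\<close> with \<open>n \<rightarrow> -\<infinity>\<close>.\<close>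

lemma members_curv_pos:
  assumes "u \<in> members" "u \<noteq> half_plane_symbol"
  shows "curv u > 0"
proof (cases "\<exists>n. u = fib_symbol n")
  case True
  then show ?thesis using phi_pos by (auto simp: fib_symbol_def)
next
  case False
  obtain a b c d where u: "u = (a, b, c, d)" by (cases u)
  have b: "b \<ge> 1"
    using members_ip_ge_one[OF assms(1) half_plane_symbol_in_members assms(2)]
    by (simp add: u half_plane_symbol_def)
  have fib: "ip u (fib_symbol n) \<ge> 1" for n
    using members_ip_ge_one[OF assms(1) fib_symbol_in_members] False by auto
  \<comment> \<open>The product with D_0 is d - b.\<close>
  have d: "d > 0" using fib[of 0] b by (simp add: u fib_symbol_0)
  have cd: "c * d = a * a + b * b - 1" using members_ip_self[OF assms(1)] by (simp add: u algebra_simps)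
  have "b * b \<ge> 1" using b mult_mono[of 1 b 1 b] by simp
  then have "c * d \<ge> 0" using cd by (smt (verit) zero_le_square)
  then have "c \<ge> 0" using d by (simp add: zero_le_mult_iff)
  moreover have "c \<noteq> 0"
  proof
    assume c: "c = 0"
    then have "a = 0" "b * b = 1" using cd \<open>b * b \<ge> 1\<close>
      by (smt (verit) mult_eq_0_iff zero_le_square)+
    \<comment> \<open>Now \<open>u\<close> would be the half-plane y >= d / 2. Its product with
      D_(-m) is d / phi^(2 m) - b, which drops below 1 for large m.\<close>
    have "phi\<^sup>2 > 1" using phi_gt_1 by (simp add: phi_square)
    then obtain m where m: "d < (phi\<^sup>2) ^ m" using real_arch_pow by blast
    have "2 * (- int m) = - int (2 * m)" by simp
    then have "phi powi (2 * (- int m)) = 1 / (phi\<^sup>2) ^ m"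
      by (simp only: power_int_minus power_int_of_nat power_mult inverse_eq_divide)
    then have "d * (1 / (phi\<^sup>2) ^ m) \<ge> 2"
      using fib[of "- int m"] b by (simp add: u c \<open>a = 0\<close> fib_symbol_def)
    moreover have "d * (1 / (phi\<^sup>2) ^ m) < 1" using m d by simp
    ultimately show False by simp
  qed
  ultimately show ?thesis by (simp add: u)
qed

section \<open>Symbols and generalized disks\<close>

text \<open>Explicit co-curvatures replace the inversion in \<open>has_symbol\<close>: (|c|^2 - r^2)
  / r for a circle and -2 b for a half-plane with offset b. The link with \<open>has_symbol\<close>
  is made at the end, for the line and the Fibonacci disks.\<close>

fun disk_of :: "symbol \<Rightarrow> sphere set" where
  "disk_of (u, v, b, g) =
     (if b = 0 then half_plane (- u, - v) (- g / 2) else circle_disk (u / b, v / b) (1 / b))"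

fun circle_symbol :: "plane \<Rightarrow> real \<Rightarrow> symbol" where
  "circle_symbol (x, y) r = (x / r, y / r, 1 / r, (x\<^sup>2 + y\<^sup>2 - r\<^sup>2) / r)"

fun line_symbol :: "plane \<Rightarrow> real \<Rightarrow> symbol" where
  "line_symbol (u, v) b = (- u, - v, 0, - 2 * b)"

lemma disk_of_circle_symbol [simp]: "r \<noteq> 0 \<Longrightarrow> disk_of (circle_symbol c r) = circle_disk c r"
  by (cases c) simp

lemma disk_of_line_symbol [simp]: "disk_of (line_symbol a b) = half_plane a b"
  by (cases a) simp

lemma dist_plane_square: "(dist (a, b) (c, d))\<^sup>2 = (a - c)\<^sup>2 + (b - d)\<^sup>2" for a b c d :: real
  by (simp add: dist_Pair_Pair dist_real_def)

text \<open>The product is the inversive distance; it equals 1 when the distance of the centres is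
  |r + s|, with signed radii.\<close>

lemma ip_circle_circle:
  assumes "r \<noteq> 0" "s \<noteq> 0"
  shows "2 * r * s * ip (circle_symbol c r) (circle_symbol d s) = (dist c d)\<^sup>2 - r\<^sup>2 - s\<^sup>2"
proof (cases c; cases d)
  fix a b a' b' assume "c = (a, b)" "d = (a', b')"
  then show ?thesis
    using assms by (simp add: dist_plane_square) (simp add: field_simps power2_eq_square)
qed

lemma ip_line_circle:
  assumes "r \<noteq> 0"
  shows "r * ip (line_symbol a b) (circle_symbol c r) = a \<bullet> c - b"
  using assms by (cases a; cases c) (simp add: field_simps)

lemma ip_line_line: "ip (line_symbol a b) (line_symbol c d) = - (a \<bullet> c)"
  by (cases a; cases c) simp

lemma ip_circle_self: "r \<noteq> 0 \<Longrightarrow> ip (circle_symbol c r) (circle_symbol c r) = -1"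
  using ip_circle_circle[of r r c c] by (simp add: power2_eq_square del: circle_symbol.simps) algebra

lemma unit_symbol_cases:
  assumes "ip e e = -1"
  obtains (circle) c r where "r \<noteq> 0" "curv e = 1 / r" "e = circle_symbol c r"
    | (line) a b where "norm a = 1" "curv e = 0" "e = line_symbol a b"
proof -
  obtain u v b g where e: "e = (u, v, b, g)" by (cases e)
  have n: "u\<^sup>2 + v\<^sup>2 = b * g + 1" using assms by (simp add: e power2_eq_square algebra_simps)
  show thesis
  proof (cases "b = 0")
    case True
    then show thesis using n by (intro line[of "(- u, - v)" "- g / 2"]) (auto simp: e norm_Pair)
  next
    case False
    have "((u / b)\<^sup>2 + (v / b)\<^sup>2 - (1 / b)\<^sup>2) * b = (u\<^sup>2 + v\<^sup>2 - 1) / b"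
      using False by (simp add: field_simps power2_eq_square)
    also have "\<dots> = g" using False n by simp
    finally show thesis using False
      by (intro circle[of "1 / b" "(u / b, v / b)"]) (auto simp: e)
  qed
qed

lemma generalized_disk_iff: "generalized_disk D \<longleftrightarrow> (\<exists>e. ip e e = -1 \<and> D = disk_of e)"
proof
  assume "generalized_disk D"
  then consider c r where "r \<noteq> 0" "D = circle_disk c r" | a b where "norm a = 1" "D = half_plane a b"
    by (auto simp: generalized_disk_def)
  then show "\<exists>e. ip e e = -1 \<and> D = disk_of e"
  proof cases
    case 1
    then show ?thesis by (intro exI[of _ "circle_symbol c r"]) (simp add: ip_circle_self)
  next
    case 2
    then show ?thesis
      by (intro exI[of _ "line_symbol a b"]) (simp add: ip_line_line flip: power2_norm_eq_inner)
  qed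
next
  assume "\<exists>e. ip e e = -1 \<and> D = disk_of e"
  then obtain e where e: "ip e e = -1" "D = disk_of e" by blast
  then show "generalized_disk D"
    by (cases rule: unit_symbol_cases)
      (metis generalized_disk_def disk_of_circle_symbol, metis generalized_disk_def disk_of_line_symbol)
qed

lemma half_plane_symbol_eq: "half_plane_symbol = line_symbol (0, 1) 0"
  by (simp add: half_plane_symbol_def)

lemma lower_half_plane_eq: "lower_half_plane = half_plane (0, 1) 0"
  by (auto simp: lower_half_plane_def half_plane_def)

lemma disk_of_half_plane_symbol: "disk_of half_plane_symbol = lower_half_plane"
  by (simp add: half_plane_symbol_eq lower_half_plane_eq del: line_symbol.simps)

lemma disk_of_fib_symbol: "disk_of (fib_symbol n) = fib_disk n"
proof -
  define t where "t = phi powi n"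
  have "t \<noteq> 0" using phi_pos by (simp add: t_def)
  moreover have e: "phi powi (2 * n) = t\<^sup>2" "phi powi (- n) = 1 / t" "phi powi (- 2 * n) = 1 / t\<^sup>2"
    by (simp_all add: t_def power_int_minus power_int_mult mult.commute[of 2] inverse_eq_divide)
  ultimately show ?thesis
    unfolding fib_symbol_def fib_disk_def e t_def[symmetric]
    by (simp add: field_simps power2_eq_square)
qed

subsection \<open>Tangency\<close>

text \<open>The sphere has no isolated point: a finite one would be an open singleton of the plane,
  and isolation of infinity would make the plane compact. Hence sets sharing at most one point have
  disjoint interiors.\<close>

lemma openin_sphere_singleton:
  assumes "openin sphere_top W" "W \<subseteq> {s}"
  shows "W = {}"
proof (rule ccontr)
  assume "W \<noteq> {}"
  with assms(2) have W: "W = {s}" by blast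
  from assms(1) consider U :: "plane set" where "open U" "W = Some ` U"
    | C :: "plane set" where "compact C" "W = insert None (Some ` (UNIV - C))"
    by (auto simp: openin_Alexandroff_compactification)
  then show False
  proof cases
    case 1
    then obtain p where p: "p \<in> U" "s = Some p" using W by blast
    then have "U = {p}" using 1 W by auto
    then show False using 1 not_open_singleton by blast
  next
    case 2
    then have "s = None" using W by blast
    then have "C = UNIV" using 2 W by auto
    then show False using 2 not_compact_UNIV by blast
  qed
qed

lemma interiors_disjoint:
  assumes "A \<inter> B \<subseteq> {s}"
  shows "(sphere_top interior_of A) \<inter> (sphere_top interior_of B) = {}"
proof (rule openin_sphere_singleton)
  show "(sphere_top interior_of A) \<inter> (sphere_top interior_of B) \<subseteq> {s}"
    using assms interior_of_subset[of sphere_top A] interior_of_subset[of sphere_top B] by blast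
qed (intro openin_Int openin_interior_of)

lemma tangentI: "A \<inter> B = {s} \<Longrightarrow> tangent A B"
  using interiors_disjoint[of A B s] by (auto simp: tangent_def)

text \<open>Refutes tangency of overlapping disks through open sets of the plane, avoiding a
  computation of interiors on the sphere.\<close>

lemma tangent_no_common_open:
  assumes "tangent A B" "open U" "Some ` U \<subseteq> A" "Some ` U \<subseteq> B"
  shows "U = {}"
proof -
  have "openin sphere_top (Some ` U)" using assms(2) by simp
  then have "Some ` U \<subseteq> sphere_top interior_of A" "Some ` U \<subseteq> sphere_top interior_of B"
    using assms interior_of_maximal by blast+
  then have "Some ` U = {}" using assms(1) unfolding tangent_def by blast
  then show ?thesis by simp
qed

lemma tangent_unique: "tangent A B \<Longrightarrow> s \<in> A \<Longrightarrow> s \<in> B \<Longrightarrow> t \<in> A \<Longrightarrow> t \<in> B \<Longrightarrow> s = t"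
  unfolding tangent_def by blast

lemma tangent_sym: "tangent A B \<Longrightarrow> tangent B A"
  unfolding tangent_def by (simp add: Int_commute)

lemma mem_disks [simp]:
  "Some p \<in> circle_disk c r \<longleftrightarrow> (if r > 0 then dist c p \<le> r else dist c p \<ge> - r)"
  "None \<in> circle_disk c r \<longleftrightarrow> \<not> r > 0"
  "Some p \<in> half_plane a b \<longleftrightarrow> a \<bullet> p \<le> b"
  "None \<in> half_plane a b"
  by (auto simp: circle_disk_def half_plane_def)

lemma obtain_direction:
  fixes v :: plane
  obtains w where "norm w = 1" "v = norm v *\<^sub>R w"
proof (cases "v = 0")
  case True
  \<comment> \<open>Any unit vector serves for the zero vector; this covers concentric
    circles.\<close>
  then show thesis using that[of "(1, 0)"] by (simp add: norm_Pair zero_prod_def)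
next
  case False
  then show thesis using that[of "v /\<^sub>R norm v"] by simp
qed

lemma tangent_disks_dist:
  assumes "tangent (circle_disk c r) (circle_disk d s)" "r > 0" "s > 0"
  shows "dist c d = r + s"
proof -
  obtain p where "p \<in> circle_disk c r" "p \<in> circle_disk d s"
    using assms(1) unfolding tangent_def by blast
  then obtain q where "dist c q \<le> r" "dist d q \<le> s"
    using assms(2,3) by (cases p) auto
  then have "dist c d \<le> r + s" by metric
  moreover have False if "dist c d < r + s"
  proof -
    \<comment> \<open>\<open>z\<close> divides the segment of the centres in the ratio r : s and
      lies in both open disks if they overlap.\<close>
    define z where "z = c + (r / (r + s)) *\<^sub>R (d - c)"
    have "dist c z = (r / (r + s)) * dist c d"
      using assms by (simp add: z_def dist_norm norm_minus_commute)
    also have "\<dots> < (r / (r + s)) * (r + s)"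
      using that assms by (intro mult_strict_left_mono) auto
    also have "\<dots> = r" using assms by simp
    finally have "dist c z < r" .
    have "d - z = (1 - r / (r + s)) *\<^sub>R (d - c)"
      by (simp add: z_def algebra_simps)
    also have "1 - r / (r + s) = s / (r + s)" using assms by (simp add: field_simps)
    finally have "dist d z = (s / (r + s)) * dist c d"
      using assms by (simp add: dist_norm norm_minus_commute)
    also have "\<dots> < (s / (r + s)) * (r + s)"
      using that assms by (intro mult_strict_left_mono) auto
    also have "\<dots> = s" using assms by simp
    finally have "dist d z < s" .
    have "ball c r \<inter> ball d s = {}"
      by (rule tangent_no_common_open[OF assms(1)]) (use assms in auto)
    then show False using \<open>dist c z < r\<close> \<open>dist d z < s\<close> by auto
  qed
  ultimately show ?thesis by fastforce
qed

lemma tangent_exterior_dist: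
  assumes "tangent (circle_disk c (- r)) (circle_disk d s)" "r > 0" "s > 0"
  shows "dist c d = r - s"
proof -
  obtain p where "p \<in> circle_disk c (- r)" "p \<in> circle_disk d s"
    using assms(1) unfolding tangent_def by blast
  then obtain q where "dist c q \<ge> r" "dist d q \<le> s"
    using assms(2,3) by (cases p) auto
  then have "dist c d \<ge> r - s" by metric
  moreover have False if "dist c d > r - s"
  proof -
    obtain w where w: "norm w = 1" "d - c = norm (d - c) *\<^sub>R w" by (rule obtain_direction)
    \<comment> \<open>Going from \<open>d\<close> away from \<open>c\<close> by some
      \<open>t < s\<close> must leave the circle of radius \<open>r\<close>; \<open>t >= 0\<close>
      makes the distances add up.\<close>
    have "max 0 (r - dist c d) < s" using that assms by auto
    then obtain t where "max 0 (r - dist c d) < t" and ts: "t < s" using dense by blast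
    then have t: "0 \<le> t" "t < s" "r < dist c d + t" by auto
    define z where "z = d + t *\<^sub>R w"
    have "dist d z < s" using t w by (simp add: z_def dist_norm)
    moreover have "z - c = (dist c d + t) *\<^sub>R w"
      using w(2) by (simp add: z_def algebra_simps dist_norm norm_minus_commute)
    then have "dist c z > r"
      using t w by (simp add: dist_norm norm_minus_commute[of c z])
    moreover have "ball d s \<inter> {z. r < dist c z} = {}"
      by (rule tangent_no_common_open[OF assms(1)])
        (use assms in \<open>auto intro!: open_Int open_Collect_less continuous_intros\<close>)
    ultimately show False by auto
  qed
  ultimately show ?thesis by fastforce
qed

lemma tangent_half_plane_disk:
  assumes "tangent (half_plane a b) (circle_disk c r)" "norm a = 1" "r > 0"
  shows "a \<bullet> c = b + r"
proof -
  obtain p where "p \<in> half_plane a b" "p \<in> circle_disk c r"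
    using assms(1) unfolding tangent_def by blast
  then obtain q where q: "a \<bullet> q \<le> b" "dist c q \<le> r"
    using assms(3) by (cases p) auto
  have "a \<bullet> (c - q) \<le> r" using norm_cauchy_schwarz[of a "c - q"] q assms by (simp add: dist_norm)
  then have "a \<bullet> c \<le> b + r" using q by (simp add: inner_diff_right)
  moreover have False if "a \<bullet> c < b + r"
  proof -
    have "max 0 (a \<bullet> c - b) < r" using that assms by auto
    then obtain t where "max 0 (a \<bullet> c - b) < t" and tr: "t < r" using dense by blast
    then have t: "0 \<le> t" "t < r" "a \<bullet> c - t < b" by auto
    define z where "z = c - t *\<^sub>R a"
    have "a \<bullet> z < b" using t assms(2) by (simp add: z_def inner_diff_right norm_eq_1)
    moreover have "dist c z < r" using t assms(2) by (simp add: z_def dist_norm)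
    moreover have "ball c r \<inter> {z. a \<bullet> z < b} = {}"
      by (rule tangent_no_common_open[OF assms(1)])
        (use assms in \<open>auto intro!: open_Int open_Collect_less continuous_intros\<close>)
    ultimately show False by auto
  qed
  ultimately show ?thesis by fastforce
qed

lemma tangent_half_plane_lower:
  assumes "tangent (half_plane a b) lower_half_plane" "norm a = 1"
  shows "a = (0, -1)"
proof (rule ccontr)
  assume "a \<noteq> (0, -1)"
  obtain u v where a: "a = (u, v)" by (cases a)
  have n: "u * u + v * v = 1" using assms(2) by (simp add: a norm_Pair power2_eq_square)
  have "v \<ge> -1" using norm_snd_le[of v u] assms(2) by (simp add: a)
  moreover have "v \<noteq> -1" using n \<open>a \<noteq> (0, -1)\<close> a by auto
  ultimately have v: "1 + v > 0" by simp
  \<comment> \<open>Both half-planes contain infinity, so a common finite point suffices. From the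
    origin one moves against the sum a + (0, 1) of the outer normals, until the product with
    \<open>a\<close> is - |b|.\<close>
  define t where "t = \<bar>b\<bar> / (1 + v)"
  have t: "t \<ge> 0" "t * (1 + v) = \<bar>b\<bar>" using v by (auto simp: t_def)
  have "a \<bullet> (- t * u, - t * (1 + v)) = - t * (u * u + v * v) - t * v"
    by (simp add: a algebra_simps)
  also have "\<dots> = - \<bar>b\<bar>" using n t by (simp add: algebra_simps)
  finally have "Some (- t * u, - t * (1 + v)) \<in> half_plane a b" by simp
  moreover have "Some (- t * u, - t * (1 + v)) \<in> lower_half_plane"
    using t v by (simp add: lower_half_plane_eq)
  ultimately show False
    using tangent_unique[OF assms(1), of None "Some (- t * u, - t * (1 + v))"] by (simp add: lower_half_plane_eq)
qed

lemma not_tangent_exterior_lower: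
  assumes "r > 0"
  shows "\<not> tangent (circle_disk c (- r)) lower_half_plane"
proof
  assume t: "tangent (circle_disk c (- r)) lower_half_plane"
  \<comment> \<open>A point of the line at horizontal distance \<open>r\<close> from the centre is
    common to both sets, besides infinity.\<close>
  have "dist c (fst c + r, 0) \<ge> r"
    using dist_fst_le[of c "(fst c + r, 0)"] by (simp add: dist_real_def)
  then show False
    using tangent_unique[OF t, of None "Some (fst c + r, 0)"] assms by (simp add: lower_half_plane_eq)
qed

text \<open>Positive curvature excludes exteriors and other half-planes; the product with the line
  is snd c / r, and its being at least 1 puts the disk above the line.\<close>

lemma members_cases:
  assumes "u \<in> members"
  obtains (lower) "u = half_plane_symbol" "disk_of u = lower_half_plane"
    | (disk) c r where "r > 0" "u = circle_symbol c r" "disk_of u = circle_disk c r" "snd c \<ge> r"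
        "u \<noteq> half_plane_symbol"
proof (cases "u = half_plane_symbol")
  case True
  then show thesis using lower disk_of_half_plane_symbol by simp
next
  case False
  with assms have pos: "curv u > 0" by (rule members_curv_pos)
  from members_ip_self[OF assms] show thesis
  proof (cases rule: unit_symbol_cases)
    case (circle c r)
    then have r: "r > 0" using pos by simp
    have "ip half_plane_symbol u \<ge> 1"
      using members_ip_ge_one[OF half_plane_symbol_in_members assms] False by auto
    then have "r * 1 \<le> r * ip half_plane_symbol u" using r by (intro mult_left_mono) auto
    also have "r * ip half_plane_symbol u = snd c"
      using ip_line_circle[of r "(0, 1)" 0 c] r circle by (simp add: half_plane_symbol_eq inner_prod_def)
    finally show thesis using disk r circle False by simp
  qed (use pos in simp)
qed

text \<open>\<open>e\<close> ranges over all generalized disks because \<open>inscribe\<close>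
  admits each of them as a candidate; only \<open>u\<close> has the restricted shape of a
  member.\<close>

lemma tangent_imp_ip_one:
  assumes "ip e e = -1" "u \<in> members" "tangent (disk_of e) (disk_of u)"
  shows "ip e u = 1"
  using assms(1)
proof (cases rule: unit_symbol_cases)
  case e: (circle c r)
  show ?thesis
  proof (cases "r > 0")
    case True
    from assms(2) show ?thesis
    proof (cases rule: members_cases)
      case lower
      then have "tangent (half_plane (0, 1) 0) (circle_disk c r)"
        using assms(3) e True tangent_sym by (simp add: lower_half_plane_eq)
      then have "(0, 1) \<bullet> c = 0 + r"
        by (rule tangent_half_plane_disk) (use True in \<open>auto simp: norm_Pair\<close>)
      then have "r * ip half_plane_symbol e = r * 1"
        using ip_line_circle[of r "(0, 1)" 0 c] e by (simp add: half_plane_symbol_eq del: line_symbol.simps)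
      then show ?thesis using True lower by (simp add: ip_commute)
    next
      case (disk d s)
      then have "dist c d = r + s" using assms(3) e True by (intro tangent_disks_dist) auto
      then have "2 * r * s * ip e u = 2 * r * s * 1"
        using ip_circle_circle[of r s c d] e disk by (simp add: power2_eq_square algebra_simps)
      then show ?thesis using True disk(1) by simp
    qed
  next
    case False
    with e have r: "- r > 0" by simp
    from assms(2) show ?thesis
    proof (cases rule: members_cases)
      case lower
      then show ?thesis using not_tangent_exterior_lower[OF r] assms(3) e by simp
    next
      case (disk d s)
      have "dist c d = - r - s"
        using disk tangent_exterior_dist[of c "- r" d s] assms(3) e r by simp
      then have "(dist c d)\<^sup>2 = r\<^sup>2 + s\<^sup>2 + 2 * r * s" by algebra
      then have "2 * r * s * ip e u = 2 * r * s * 1"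
        using ip_circle_circle[of r s c d] e disk by simp
      then show ?thesis using r disk(1) by simp
    qed
  qed
next
  case e: (line a b)
  from assms(2) show ?thesis
  proof (cases rule: members_cases)
    case lower
    then have "a = (0, -1)" using tangent_half_plane_lower assms(3) e by simp
    then show ?thesis using lower e by (simp add: half_plane_symbol_def)
  next
    case (disk c r)
    then have "a \<bullet> c = b + r" using tangent_half_plane_disk assms(3) e by simp
    then have "r * ip e u = r * 1" using ip_line_circle[of r a b c] e disk by simp
    then show ?thesis using disk(1) by simp
  qed
qed

text \<open>A common point \<open>q\<close> has projection at least \<open>r\<close> on the line of
  centres but distance at most \<open>r\<close> from \<open>c\<close>; this equality case of
  Cauchy-Schwarz forces \<open>q = z\<close>.\<close>

lemma touching_disks:
  assumes "r > 0" "s > 0" "dist c d \<ge> r + s"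
  obtains p where "circle_disk c r \<inter> circle_disk d s \<subseteq> {p}"
    "dist c d = r + s \<Longrightarrow> circle_disk c r \<inter> circle_disk d s = {p}"
proof -
  obtain w where w: "norm w = 1" "d - c = norm (d - c) *\<^sub>R w" by (rule obtain_direction)
  define z where "z = c + r *\<^sub>R w"
  have "q = z" if q: "dist c q \<le> r" "dist d q \<le> s" for q
  proof -
    have "w \<bullet> (d - c) = dist c d"
      using w by (subst w(2)) (simp add: dist_norm norm_minus_commute norm_eq_1)
    moreover have "w \<bullet> (d - q) \<le> s"
      using norm_cauchy_schwarz[of w "d - q"] q w by (simp add: dist_norm)
    ultimately have "w \<bullet> (q - c) \<ge> r" using assms by (simp add: inner_diff_right)
    moreover have "(norm (q - c))\<^sup>2 \<le> r\<^sup>2"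
      using q by (intro power_mono) (auto simp: dist_norm norm_minus_commute)
    moreover have "(norm (q - z))\<^sup>2 = (norm (q - c))\<^sup>2 - 2 * r * (w \<bullet> (q - c)) + r\<^sup>2"
    proof -
      have "(norm (x - r *\<^sub>R w))\<^sup>2 = (norm x)\<^sup>2 - 2 * r * (w \<bullet> x) + r\<^sup>2" for x
        using w(1) by (simp only: power2_norm_eq_inner norm_eq_1 inner_diff_left inner_diff_right
            inner_scaleR_left inner_scaleR_right inner_commute[of x w]) (simp add: power2_eq_square algebra_simps)
      from this[of "q - c"] show ?thesis by (simp add: z_def diff_diff_eq)
    qed
    ultimately have "(norm (q - z))\<^sup>2 \<le> r\<^sup>2 - 2 * r * r + r\<^sup>2"
      using assms(1) mult_left_mono[of r "w \<bullet> (q - c)" "2 * r"] by linarith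
    then have "(norm (q - z))\<^sup>2 \<le> 0" by (simp add: power2_eq_square)
    then show ?thesis by simp
  qed
  then have sub: "circle_disk c r \<inter> circle_disk d s \<subseteq> {Some z}"
    using assms by (auto simp: circle_disk_def)
  have "Some z \<in> circle_disk c r \<inter> circle_disk d s" if "dist c d = r + s"
  proof -
    have "norm (d - c) = r + s" using that by (simp add: dist_norm norm_minus_commute)
    then have "d - c = (r + s) *\<^sub>R w" using w(2) by metis
    moreover have "d - z = (d - c) - r *\<^sub>R w" by (simp add: z_def)
    ultimately have "d - z = s *\<^sub>R w" by (simp add: scaleR_add_left)
    then have "dist d z = s" using w(1) assms by (simp add: dist_norm)
    then show ?thesis using w(1) assms by (simp add: z_def dist_norm)
  qed
  with sub that show thesis by blast
qed

lemma touching_lower_half_plane: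
  assumes "r > 0" "snd c \<ge> r"
  shows "lower_half_plane \<inter> circle_disk c r \<subseteq> {Some (fst c, 0)}"
    and "snd c = r \<Longrightarrow> lower_half_plane \<inter> circle_disk c r = {Some (fst c, 0)}"
proof -
  have "p = (fst c, 0)" if "snd p \<le> 0" "dist c p \<le> r" for p
  proof -
    have "(fst c - fst p)\<^sup>2 + (snd c - snd p)\<^sup>2 \<le> r\<^sup>2"
      using power_mono[OF that(2), of 2] by (cases c; cases p) (simp add: dist_Pair_Pair dist_real_def)
    moreover have "(snd c - snd p)\<^sup>2 \<ge> r\<^sup>2" using that assms by (intro power_mono) auto
    ultimately have "(fst c - fst p)\<^sup>2 \<le> 0" "(snd c - snd p)\<^sup>2 \<le> r\<^sup>2"
      using zero_le_power2[of "fst c - fst p"] by linarith+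
    then have "fst c = fst p" by simp
    have "snd c - snd p \<le> r"
      using power2_le_imp_le[OF \<open>(snd c - snd p)\<^sup>2 \<le> r\<^sup>2\<close>] assms(1) by simp
    then show ?thesis using that assms \<open>fst c = fst p\<close> by (simp add: prod_eq_iff)
  qed
  then show sub: "lower_half_plane \<inter> circle_disk c r \<subseteq> {Some (fst c, 0)}"
    using assms by (fastforce simp: circle_disk_def lower_half_plane_def)
  assume "snd c = r"
  then have "dist c (fst c, 0) \<le> r"
    using assms by (cases c) (simp add: dist_Pair_Pair dist_real_def)
  then show "lower_half_plane \<inter> circle_disk c r = {Some (fst c, 0)}"
    using sub assms by (auto simp: lower_half_plane_eq)
qed

text \<open>Turns products into intersections. The inclusion yields disjoint interiors, the equality
  yields tangency.\<close>

lemma members_touching: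
  assumes "u \<in> members" "w \<in> members" "u \<noteq> w"
  obtains p where "disk_of u \<inter> disk_of w \<subseteq> {p}" "ip u w = 1 \<Longrightarrow> disk_of u \<inter> disk_of w = {p}"
proof -
  have *: "\<exists>p. disk_of u \<inter> disk_of w \<subseteq> {p} \<and> (ip u w = 1 \<longrightarrow> disk_of u \<inter> disk_of w = {p})"
    if "u = half_plane_symbol" "w \<in> members" "u \<noteq> w" for u w
    using that(2)
  proof (cases rule: members_cases)
    case (disk c r)
    have "r * ip half_plane_symbol w = snd c"
      using ip_line_circle[of r "(0, 1)" 0 c] disk by (simp add: half_plane_symbol_eq inner_prod_def)
    then have "ip u w = 1 \<Longrightarrow> snd c = r" using that by simp
    then show ?thesis
      using touching_lower_half_plane[of r c] disk(1,3,4) that(1) disk_of_half_plane_symbol by auto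
  qed (use that in simp)
  show thesis
  proof (cases "u = half_plane_symbol \<or> w = half_plane_symbol")
    case True
    then have "\<exists>p. disk_of u \<inter> disk_of w \<subseteq> {p} \<and> (ip u w = 1 \<longrightarrow> disk_of u \<inter> disk_of w = {p})"
    proof
      assume "w = half_plane_symbol"
      then show ?thesis
        unfolding Int_commute[of "disk_of u"] ip_commute[of u] by (intro *) (use assms in auto)
    qed (use * assms in blast)
    then show thesis using that by blast
  next
    case False
    obtain c r where u: "r > 0" "u = circle_symbol c r" "disk_of u = circle_disk c r"
      using assms(1) False by (cases rule: members_cases) auto
    obtain d s where w: "s > 0" "w = circle_symbol d s" "disk_of w = circle_disk d s"
      using assms(2) False by (cases rule: members_cases) auto
    have eq: "(dist c d)\<^sup>2 = r\<^sup>2 + s\<^sup>2 + 2 * r * s * ip u w"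
      using ip_circle_circle[of r s c d] u w by simp
    have "2 * r * s * ip u w \<ge> 2 * r * s * 1"
      using members_ip_ge_one[OF assms] u w by (intro mult_left_mono) auto
    then have "(dist c d)\<^sup>2 \<ge> (r + s)\<^sup>2" using eq by (simp add: power2_sum)
    then have ge: "dist c d \<ge> r + s" using power2_le_imp_le by fastforce
    moreover have "dist c d = r + s" if "ip u w = 1"
    proof -
      have "(dist c d)\<^sup>2 = (r + s)\<^sup>2" using eq that by (simp add: power2_sum)
      then show ?thesis using u w by (simp add: power2_eq_iff_nonneg)
    qed
    moreover obtain p where "circle_disk c r \<inter> circle_disk d s \<subseteq> {p}"
      "dist c d = r + s \<Longrightarrow> circle_disk c r \<inter> circle_disk d s = {p}"
      using touching_disks[OF u(1) w(1) ge] by blast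
    ultimately show thesis using that u(3) w(3) by metis
  qed
qed

lemma members_tangent_iff:
  assumes "u \<in> members" "w \<in> members"
  shows "tangent (disk_of u) (disk_of w) \<longleftrightarrow> ip u w = 1"
proof
  assume "ip u w = 1"
  then have "u \<noteq> w" using members_ip_self[OF assms(1)] by auto
  then obtain p where "disk_of u \<inter> disk_of w = {p}"
    using members_touching[OF assms] \<open>ip u w = 1\<close> by metis
  then show "tangent (disk_of u) (disk_of w)" by (rule tangentI)
next
  assume "tangent (disk_of u) (disk_of w)"
  then show "ip u w = 1" by (rule tangent_imp_ip_one[OF members_ip_self[OF assms(1)] assms(2)])
qed

lemma generalized_disk_members: "u \<in> members \<Longrightarrow> generalized_disk (disk_of u)"
  using generalized_disk_iff members_ip_self by blast

text \<open>Distinct members with the same disk would make that disk lie in a single point.\<close>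

lemma inj_on_disk_of: "inj_on disk_of members"
proof (rule inj_onI, rule ccontr)
  fix u w assume uw: "u \<in> members" "w \<in> members" "disk_of u = disk_of w" "u \<noteq> w"
  then obtain p where p: "disk_of u \<subseteq> {p}" using members_touching[OF uw(1,2,4)] by (metis Int_absorb)
  from uw(1) show False
  proof (cases rule: members_cases)
    case lower
    then have "Some (0, 0) \<in> disk_of u" "None \<in> disk_of u" by (auto simp: lower_half_plane_eq)
    then show ?thesis using p by auto
  next
    case (disk c r)
    then have "Some c \<in> disk_of u" "Some (c + (r, 0)) \<in> disk_of u" by (auto simp: dist_norm norm_Pair)
    then have "c = c + (r, 0)" using p by (metis subsetD singletonD option.inject)
    then have "fst c = fst (c + (r, 0))" by simp
    then show ?thesis using disk by simp
  qed
qed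

subsection \<open>The packing as the set of member disks\<close>

definition fib_packing :: "sphere set set" where
  "fib_packing = packing_of {lower_half_plane, fib_disk 0, fib_disk 1}"

lemma quads_fourth_in_packing:
  assumes "v \<in> quads" "distinct [i, j, k, l]"
    and "disk_of (v i) \<in> packing_of S" "disk_of (v j) \<in> packing_of S" "disk_of (v k) \<in> packing_of S"
  shows "disk_of (v l) \<in> packing_of S"
proof -
  have "tangent (disk_of (v a)) (disk_of (v b))" if "a \<noteq> b" for a b
    using members_tangent_iff[OF quads_subset_members quads_subset_members, OF assms(1) assms(1)]
      descartesD(1)[OF descartes_quads[OF assms(1)], of a b] that by simp
  then show ?thesis
    using assms(2) generalized_disk_members[OF quads_subset_members[OF assms(1)]]
    by (intro packing_of.inscribe[OF assms(3-5)]) auto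
qed

text \<open>Members are closed under inscribing, since a tangent triple extends to a quadruple of
  the orbit and both disks completing it are members. Conversely a move keeps three disks of a
  quadruple, and these inscribe the fourth.\<close>

lemma fib_packing_eq: "fib_packing = disk_of ` members"
proof
  show "fib_packing \<subseteq> disk_of ` members"
  proof
    fix E assume "E \<in> fib_packing"
    then show "E \<in> disk_of ` members"
      unfolding fib_packing_def
    proof (induction rule: packing_of.induct)
      case (seed_mem A)
      then show ?case
        using half_plane_symbol_in_members fib_symbol_in_members disk_of_half_plane_symbol disk_of_fib_symbol
        by (metis image_eqI insertE singletonD)
    next
      case (inscribe A B C E)
      then obtain a b c where m: "a \<in> members" "b \<in> members" "c \<in> members"
        and eq: "A = disk_of a" "B = disk_of b" "C = disk_of c"
        by blast
      have "ip a b = 1" "ip a c = 1" "ip b c = 1"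
        using \<open>tangent A B\<close> \<open>tangent A C\<close> \<open>tangent B C\<close> unfolding eq by (simp_all only: members_tangent_iff m)
      then obtain v i j k l where v: "v \<in> quads" "distinct [i, j, k, l]" "v i = a" "v j = b" "v k = c"
        by (rule tangent_triple_in_quad[OF m])
      obtain e where e: "ip e e = -1" "E = disk_of e"
        using \<open>generalized_disk E\<close> generalized_disk_iff by blast
      have "ip a e = 1" "ip b e = 1" "ip c e = 1"
        using tangent_imp_ip_one[OF e(1)] m \<open>tangent E A\<close> \<open>tangent E B\<close> \<open>tangent E C\<close>
        unfolding eq e(2) by (simp_all add: ip_commute[of _ e])
      then have "e \<in> members"
        using v(3-5) by (intro tangent_to_triple_in_members[OF v(1,2) e(1)]) simp_all
      then show ?case using e(2) by blast
    qed
  qed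
next
  have "\<forall>i. disk_of (v i) \<in> fib_packing" if "v \<in> quads" for v
    using that
  proof (induction rule: quads_induct)
    case base
    have b: "disk_of (base_quad 0) \<in> fib_packing" "disk_of (base_quad 1) \<in> fib_packing"
      "disk_of (base_quad 2) \<in> fib_packing"
      unfolding fib_packing_def
      by (auto simp: base_quad_def disk_of_half_plane_symbol disk_of_fib_symbol intro: packing_of.seed_mem)
    then have "disk_of (base_quad 3) \<in> fib_packing"
      unfolding fib_packing_def
      by (rule quads_fourth_in_packing[OF base_quad_in_quads distinct_base_indices])
    with b show ?case unfolding all_distinct_indices[OF distinct_base_indices] by blast
  next
    case (reflect v k)
    obtain i j l where d: "distinct [k, i, j, l]" by (rule obtain_three_indices)
    then have d': "distinct [i, j, l, k]" by auto
    have r: "disk_of (reflect k v m) \<in> fib_packing" if "m \<noteq> k" for m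
      using reflect that by simp
    then have "disk_of (reflect k v k) \<in> fib_packing"
      unfolding fib_packing_def
      by (intro quads_fourth_in_packing[OF reflect_in_quads[OF reflect(1)] d']) (use d in auto)
    with r show ?case by metis
  qed
  then show "disk_of ` members \<subseteq> fib_packing" by (auto simp: members_def)
qed

section \<open>The Fibonacci configurations and the seed\<close>

lemma pairwise_tangent_quad:
  assumes "v \<in> quads"
  shows "pairwise tangent (disk_of ` v ` I)"
  unfolding pairwise_image
proof (intro pairwiseI impI)
  fix i j :: 4 assume "i \<noteq> j"
  then show "tangent (disk_of (v i)) (disk_of (v j))"
    using members_tangent_iff[OF quads_subset_members quads_subset_members, OF assms assms]
      descartesD(1)[OF descartes_quads[OF assms], of i j] by simp
qed

lemma inj_disk_of_quad:
  assumes "v \<in> quads"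
  shows "inj (disk_of \<circ> v)"
  using descartes_inj[OF descartes_quads[OF assms]] inj_on_disk_of quads_subset_members[OF assms]
  by (intro comp_inj_on) (auto elim: inj_on_subset)

lemma fib_descartes_configuration:
  "descartes_configuration {lower_half_plane, fib_disk n, fib_disk (n + 1), fib_disk (n + 2)}"
proof -
  obtain v i j k l where v: "v \<in> quads" "distinct [i, j, k, l]" and
    e: "v i = half_plane_symbol" "v j = fib_symbol n" "v k = fib_symbol (n + 1)" "v l = fib_symbol (n + 2)"
    using fib_quad[of n] by blast
  have S: "{lower_half_plane, fib_disk n, fib_disk (n + 1), fib_disk (n + 2)} = range (disk_of \<circ> v)"
    unfolding range_distinct_indices[OF v(2)]
    by (simp add: e disk_of_half_plane_symbol disk_of_fib_symbol)
  have "card (range (disk_of \<circ> v)) = 4"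
    using card_image[OF inj_disk_of_quad[OF v(1)]] by simp
  moreover have "pairwise tangent (range (disk_of \<circ> v))"
    using pairwise_tangent_quad[OF v(1), of UNIV] by (simp add: image_comp)
  moreover have "\<forall>A\<in>range (disk_of \<circ> v). generalized_disk A"
    using generalized_disk_members[OF quads_subset_members[OF v(1)]] by simp
  ultimately show ?thesis unfolding S descartes_configuration_def by blast
qed

lemma fib_seed: "seed {lower_half_plane, fib_disk 0, fib_disk 1}"
proof -
  have d: "descartes_configuration {lower_half_plane, fib_disk 0, fib_disk 1, fib_disk 2}"
    using fib_descartes_configuration[of 0] by (simp only: add_0)
  then have c: "card {lower_half_plane, fib_disk 0, fib_disk 1, fib_disk 2} = 4"
    unfolding descartes_configuration_def by blast
  from d have "\<forall>A\<in>{lower_half_plane, fib_disk 0, fib_disk 1, fib_disk 2}. generalized_disk A"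
    and "pairwise tangent {lower_half_plane, fib_disk 0, fib_disk 1, fib_disk 2}"
    unfolding descartes_configuration_def by blast+
  moreover have "card {lower_half_plane, fib_disk 0, fib_disk 1} = 3"
    using c by (auto simp: card_insert_if split: if_splits)
  ultimately show ?thesis unfolding seed_def by (auto elim: pairwise_subset)
qed

section \<open>Density\<close>

text \<open>Points become isotropic vectors. The product with a circle of radius r is the power of
  the point divided by 2 r, so its sign tells inside from outside.\<close>

fun lift :: "plane \<Rightarrow> symbol" where
  "lift (x, y) = (x, y, 1, x\<^sup>2 + y\<^sup>2)"

lemma ip_lift_self: "ip (lift p) (lift p) = 0"
  by (cases p) (simp add: power2_eq_square field_simps)

lemma ip_circle_lift:
  assumes "r \<noteq> 0"
  shows "2 * r * ip (circle_symbol c r) (lift p) = (dist c p)\<^sup>2 - r\<^sup>2"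
proof (cases c; cases p)
  fix a b a' b' assume "c = (a, b)" "p = (a', b')"
  then show ?thesis
    using assms by (simp add: dist_plane_square) (simp add: field_simps power2_eq_square)
qed

lemma ip_circle_lift_le_iff:
  assumes "r > 0"
  shows "ip (circle_symbol c r) (lift p) \<le> 0 \<longleftrightarrow> dist c p \<le> r"
proof -
  have "ip (circle_symbol c r) (lift p) \<le> 0 \<longleftrightarrow> 2 * r * ip (circle_symbol c r) (lift p) \<le> 0"
    using assms by (simp add: mult_le_0_iff)
  also have "\<dots> \<longleftrightarrow> (dist c p)\<^sup>2 \<le> r\<^sup>2" using assms ip_circle_lift[of r c p] by simp
  also have "\<dots> \<longleftrightarrow> dist c p \<le> r" using assms by (simp add: power2_le_iff_abs_le)
  finally show ?thesis .
qed

text \<open>Up to sign the circle orthogonal to the three members of \<open>v\<close> other than \<open>v k\<close>; its disk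
  contains the curvilinear triangle between them that does not meet \<open>v k\<close>.\<close>

definition dual :: "(4 \<Rightarrow> symbol) \<Rightarrow> 4 \<Rightarrow> symbol" where
  "dual v k = (1 / 2) *\<^sub>R sum v UNIV - v k"

text \<open>Stated for any linear functional because it serves both for \<open>curv\<close> and for
  the product with a point. The second clause passes to a smaller gap after inscribing, the third
  evaluates the inscribed disk.\<close>

lemma dual_linear:
  assumes "linear (f :: symbol \<Rightarrow> real)" "distinct [k, i, j, l]"
  shows "f (dual v k) = (f (v i) + f (v j) + f (v l) - f (v k)) / 2"
    and "f (dual (reflect k v) i) = f (dual v k) + f (v j) + f (v l)"
    and "f (reflect k v k) = f (v i) + f (v j) + f (v l) + 2 * f (dual v k)"
proof -
  note lin = linear_diff[OF assms(1)] linear_cmul[OF assms(1)] linear_add[OF assms(1)]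
  have S: "f (sum v UNIV) = f (v k) + f (v i) + f (v j) + f (v l)"
    by (simp add: sum_distinct_indices[OF assms(2)] lin)
  then show 1: "f (dual v k) = (f (v i) + f (v j) + f (v l) - f (v k)) / 2"
    by (simp add: dual_def lin)
  have "i \<noteq> k" using assms(2) by auto
  then have "f (dual (reflect k v) i) = (3 * f (sum v UNIV) - 4 * f (v k)) / 2 - f (v i)"
    by (simp add: dual_def sum_reflect lin)
  then show "f (dual (reflect k v) i) = f (dual v k) + f (v j) + f (v l)"
    by (simp add: S 1 field_simps)
  show "f (reflect k v k) = f (v i) + f (v j) + f (v l) + 2 * f (dual v k)"
    by (simp add: 1 reflect_same[OF assms(2)] lin)
qed

lemma ip_dual:
  assumes "descartes v"
  shows "ip (dual v k) (v i) = (if i = k then 2 else 0)" "ip (dual v k) (dual v k) = -1"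
proof -
  have 1: "ip (dual v k) (v i) = (if i = k then 2 else 0)" for i
    using descartes_sum_ip[OF assms] descartesD(1)[OF assms]
    by (simp add: dual_def del: ip_linear(4))
  show "ip (dual v k) (v i) = (if i = k then 2 else 0)" by (rule 1)
  show "ip (dual v k) (dual v k) = -1"
    by (subst (2) dual_def) (simp add: 1)
qed

text \<open>Here \<open>q = - sqrt (a b + b c + c a)\<close> and \<open>a + b + c + 2 q\<close> is the value at the inscribed disk.\<close>

lemma soddy_split_ordered:
  fixes a b c q :: real
  assumes "0 < b" "b \<le> a" "a \<le> c" "q \<le> 0" "q\<^sup>2 = a * b + b * c + c * a" "a + b + c + 2 * q > 0"
  shows "q + a + b \<le> 0"
proof (rule ccontr)
  assume "\<not> ?thesis"
  then have "(- q)\<^sup>2 < (a + b)\<^sup>2" using assms by (intro power_strict_mono) auto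
  then have "c * (a + b) < a\<^sup>2 + b\<^sup>2 + a * b" using assms(5) by (simp add: power2_eq_square algebra_simps)
  also have "\<dots> \<le> (a + b) * (a + b)" using assms by (simp add: power2_eq_square algebra_simps)
  finally have "c < a + b" using assms by (simp add: mult_less_cancel_right)
  \<comment> \<open>This product and the next add up to 2 (a b + b c + c a) - a^2 - b^2 - c^2, which
    is thus positive; positivity at the inscribed disk makes it negative.\<close>
  then have "(c - a) * (a + b - c) \<ge> 0" using assms by simp
  moreover have "b * (c + 3 * a - b) > 0" using assms by simp
  moreover have "(- 2 * q)\<^sup>2 < (a + b + c)\<^sup>2" using assms by (intro power_strict_mono) auto
  then have "4 * (a * b + b * c + c * a) < (a + b + c)\<^sup>2" using assms(5) by (simp add: power2_eq_square)
  ultimately show False by (simp add: power2_eq_square algebra_simps)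
qed

text \<open>For a point outside the inscribed disk: \<open>a\<close>, \<open>b\<close>,
  \<open>c\<close> are its products with the three disks, \<open>q\<close> with the dual circle, and
  the three sums are its products with the dual circles of the smaller gaps. The two smallest of
  \<open>a\<close>, \<open>b\<close>, \<open>c\<close> always work.\<close>

lemma soddy_split:
  fixes a b c q :: real
  assumes "0 < a" "0 < b" "0 < c" "q \<le> 0" "q\<^sup>2 = a * b + b * c + c * a" "a + b + c + 2 * q > 0"
  shows "q + a + b \<le> 0 \<or> q + a + c \<le> 0 \<or> q + b + c \<le> 0"
proof -
  consider "b \<le> a" "a \<le> c" | "a \<le> b" "b \<le> c" | "c \<le> a" "a \<le> b" | "a \<le> c" "c \<le> b"
    | "c \<le> b" "b \<le> a" | "b \<le> c" "c \<le> a" by linarith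
  then show ?thesis
  proof cases
    case 1 then show ?thesis using soddy_split_ordered[of b a c q] assms by (simp add: algebra_simps)
  next
    case 2 then show ?thesis using soddy_split_ordered[of a b c q] assms by (simp add: algebra_simps)
  next
    case 3 then show ?thesis using soddy_split_ordered[of c a b q] assms by (simp add: algebra_simps)
  next
    case 4 then show ?thesis using soddy_split_ordered[of a c b q] assms by (simp add: algebra_simps)
  next
    case 5 then show ?thesis using soddy_split_ordered[of c b a q] assms by (simp add: algebra_simps)
  next
    case 6 then show ?thesis using soddy_split_ordered[of b c a q] assms by (simp add: algebra_simps)
  qed
qed

text \<open>The line has curvature 0 and is exempt from the bound \<open>m\<close>. As it occurs at
  most once, any two of the three bounding disks still have curvature sum at least
  \<open>m\<close>.\<close>

definition in_gap :: "plane \<Rightarrow> real \<Rightarrow> (4 \<Rightarrow> symbol) \<Rightarrow> 4 \<Rightarrow> bool" where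
  "in_gap p m v k \<longleftrightarrow> v \<in> quads \<and> ip (dual v k) (lift p) \<le> 0 \<and>
     (\<forall>i. i \<noteq> k \<longrightarrow> v i = half_plane_symbol \<or> m \<le> curv (v i))"

lemma members_curv_nonneg: "u \<in> members \<Longrightarrow> curv u \<ge> 0"
  using members_curv_pos[of u] by (cases "u = half_plane_symbol") (auto simp: half_plane_symbol_def)

lemma in_gap_curv_sum:
  assumes "in_gap p m v k" "m > 0" "i \<noteq> k" "j \<noteq> k" "i \<noteq> j"
  shows "m \<le> curv (v i) + curv (v j)"
proof -
  have v: "v \<in> quads" using assms(1) by (simp add: in_gap_def)
  have "v i \<noteq> half_plane_symbol \<or> v j \<noteq> half_plane_symbol"
    using injD[OF descartes_inj[OF descartes_quads[OF v]], of i j] assms(5) by auto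
  then show ?thesis
    using assms(1,3,4) members_curv_nonneg[OF quads_subset_members[OF v]]
    unfolding in_gap_def by (smt (verit))
qed

lemma gap_descend:
  assumes "\<And>u. u \<in> members \<Longrightarrow> ip u (lift p) > 0" "in_gap p m v k" "m > 0" "0 \<le> curv (dual v k)"
  obtains w j where "in_gap p m w j" "curv (dual v k) + m \<le> curv (dual w j)"
proof -
  obtain a b c where d: "distinct [k, a, b, c]" by (rule obtain_three_indices)
  have v: "v \<in> quads" and q: "ip (dual v k) (lift p) \<le> 0" using assms(2) by (auto simp: in_gap_def)
  let ?x = "\<lambda>i. ip (v i) (lift p)" and ?q = "ip (dual v k) (lift p)"
  note lin = dual_linear[OF linear_ip]
  have pos: "?x i > 0" for i using assms(1) quads_subset_members[OF v] by blast
  \<comment> \<open>Descartes' theorem for the isotropic vector of \<open>p\<close>; eliminating the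
    product with \<open>v k\<close> gives the relation required by
    \<open>soddy_split\<close>.\<close>
  have "4 * ip (lift p) (lift p) = (?x k + ?x a + ?x b + ?x c)\<^sup>2
      - 2 * ((?x k)\<^sup>2 + (?x a)\<^sup>2 + (?x b)\<^sup>2 + (?x c)\<^sup>2)"
    unfolding descartes_ip[OF descartes_quads[OF v]] sum_distinct_indices[OF d] by (simp add: power2_eq_square)
  moreover have "?x k = ?x a + ?x b + ?x c - 2 * ?q" using lin(1)[OF d, of v "lift p"] by simp
  ultimately have sq: "?q\<^sup>2 = ?x a * ?x b + ?x b * ?x c + ?x c * ?x a"
    unfolding ip_lift_self by algebra
  have "?x a + ?x b + ?x c + 2 * ?q > 0"
    using assms(1)[OF quads_subset_members[OF reflect_in_quads[OF v]], of k k] lin(3)[OF d, of v "lift p"] by simp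
  note split = soddy_split[OF pos[of a] pos[of b] pos[of c] q sq this]
  have main: "\<exists>w j. in_gap p m w j \<and> curv (dual v k) + m \<le> curv (dual w j)"
    if d: "distinct [k, a, b, c]" and le: "?q + ?x b + ?x c \<le> 0" for a b c
  proof (intro exI conjI)
    \<comment> \<open>The new disk inherits the bound \<open>m\<close>: two of the summands already
      reach it and the rest is nonnegative.\<close>
    have "curv (reflect k v k) = curv (v a) + curv (v b) + curv (v c) + 2 * curv (dual v k)"
      by (rule dual_linear(3)[OF linear_curv d])
    moreover have "m \<le> curv (v a) + curv (v b)" by (rule in_gap_curv_sum[OF assms(2,3)]) (use d in auto)
    ultimately have k: "m \<le> curv (reflect k v k)"
      using members_curv_nonneg[OF quads_subset_members[OF v], of c] assms(4) by simp
    have "reflect k v i = half_plane_symbol \<or> m \<le> curv (reflect k v i)" for i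
      using k assms(2) by (cases "i = k") (auto simp: in_gap_def)
    then show "in_gap p m (reflect k v) a"
      using reflect_in_quads[OF v] lin(2)[OF d, of v "lift p"] le by (simp add: in_gap_def)
    show "curv (dual v k) + m \<le> curv (dual (reflect k v) a)"
      using dual_linear(2)[OF linear_curv d, of v] in_gap_curv_sum[OF assms(2,3), of b c] d by auto
  qed
  have "\<exists>w j. in_gap p m w j \<and> curv (dual v k) + m \<le> curv (dual w j)"
    using split main[of c a b] main[of b a c] main[of a b c] d by auto
  then show thesis using that by blast
qed

text \<open>The dual disk of radius s contains \<open>p\<close>. A bounding disk of radius r is
  orthogonal to it, so the squared distance of centres is s^2 + r^2 <= (s + r)^2 and the two disks
  meet within 2 s of \<open>p\<close>.\<close>

lemma gap_near_member:
  assumes "in_gap p m v k" "m > 0" "curv (dual v k) > 0"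
  obtains u z where "u \<in> members" "u \<noteq> half_plane_symbol" "Some z \<in> disk_of u" "dist p z \<le> 2 / curv (dual v k)"
proof -
  have v: "v \<in> quads" and q: "ip (dual v k) (lift p) \<le> 0" using assms(1) by (auto simp: in_gap_def)
  note D = descartes_quads[OF v]
  obtain a b c where d: "distinct [k, a, b, c]" by (rule obtain_three_indices)
  then have "v a \<noteq> v b" using injD[OF descartes_inj[OF D], of a b] by auto
  then obtain i where i: "i \<noteq> k" "v i \<noteq> half_plane_symbol" using d by (metis distinct_length_2_or_more)
  obtain e s where s: "s > 0" "dual v k = circle_symbol e s" "s = 1 / curv (dual v k)"
    using ip_dual(2)[OF D, of k] assms(3) by (cases rule: unit_symbol_cases) auto
  from quads_subset_members[OF v, of i] obtain c r where r: "r > 0" "v i = circle_symbol c r"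
    "disk_of (v i) = circle_disk c r"
    by (cases rule: members_cases) (use i in auto)
  have "(dist e c)\<^sup>2 = s\<^sup>2 + r\<^sup>2"
    using ip_circle_circle[of s r e c] ip_dual(1)[OF D, of k i] i s(1,2) r by simp
  also have "\<dots> \<le> (s + r)\<^sup>2" using s(1) r(1) by (simp add: power2_sum)
  finally have le: "dist e c \<le> s + r" using s(1) r(1) power2_le_imp_le by fastforce
  define z where "z = c + (r / (s + r)) *\<^sub>R (e - c)"
  have "dist c z = r * (dist e c / (s + r))"
    using s(1) r(1) by (simp add: z_def dist_norm norm_minus_commute)
  also have "\<dots> \<le> r * 1" using s(1) r(1) le by (intro mult_left_mono) auto
  finally have cz: "dist c z \<le> r" by simp
  have "e - z = (1 - r / (s + r)) *\<^sub>R (e - c)" by (simp add: z_def algebra_simps)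
  also have "1 - r / (s + r) = s / (s + r)" using s(1) r(1) by (simp add: field_simps)
  finally have "dist e z = s * (dist e c / (s + r))"
    using s(1) r(1) by (simp add: dist_norm)
  also have "\<dots> \<le> s * 1" using s(1) r(1) le by (intro mult_left_mono) auto
  finally have ez: "dist e z \<le> s" by simp
  have "dist e p \<le> s" using q s(2) ip_circle_lift_le_iff[OF s(1)] by simp
  with ez have "dist p z \<le> 2 * s" by metric
  moreover have "Some z \<in> disk_of (v i)" using cz r by simp
  ultimately show thesis using that[of "v i" z] quads_subset_members[OF v] i s(3) by simp
qed

section \<open>A starting gap around an arbitrary point\<close>

lemma bifib_backward: "a = b + 1 \<Longrightarrow> c = b - 1 \<Longrightarrow> bifib c = bifib a - bifib b"
  using bifib_rec[of b] by simp

text \<open>Binet's formula at negative indices. The signs alternate with parity, so the contact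
  points F_n phi^(-n) run off to both ends of the line.\<close>

lemma bifib_negative:
  fixes m :: nat
  shows "sqrt 5 * bifib (- 2 * int m) = 1 / phi ^ (2 * m) - phi ^ (2 * m) \<and>
         sqrt 5 * bifib (- 2 * int m - 1) = 1 / (phi * phi ^ (2 * m)) + phi * phi ^ (2 * m)"
proof (induction m)
  case 0
  have "bifib (-1) = 1" using bifib_rec[of 0] by (simp add: bifib_0 bifib_1)
  moreover have i: "1 / phi = phi - 1" using phi_pos phi_square by (simp add: field_simps power2_eq_square)
  have "sqrt 5 = 1 / phi + phi" unfolding i by (simp add: phi_def field_simps)
  ultimately show ?case by (simp add: bifib_0)
next
  case (Suc m)
  define s where "s = phi ^ (2 * m)"
  have s: "s > 0" using phi_pos by (simp add: s_def)
  have S: "phi ^ (2 * Suc m) = s * phi\<^sup>2" by (simp add: s_def power_add power2_eq_square)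
  have i: "1 / phi = phi - 1" using phi_pos phi_square by (simp add: field_simps power2_eq_square)
  have "bifib (- 2 * int m - 2) = bifib (- 2 * int m) - bifib (- 2 * int m - 1)"
    by (rule bifib_backward) simp_all
  then have "sqrt 5 * bifib (- 2 * int m - 2) = (1 / s - s) - (1 / (phi * s) + phi * s)"
    using Suc by (simp add: s_def right_diff_distrib)
  also have "\<dots> = (1 - 1 / phi) / s - (1 + phi) * s" using s by (simp add: field_simps)
  also have "1 - 1 / phi = 1 / phi\<^sup>2"
    using phi_pos phi_square by (simp add: field_simps power2_eq_square)
  finally have 1: "sqrt 5 * bifib (- 2 * int m - 2) = 1 / (s * phi\<^sup>2) - s * phi\<^sup>2"
    by (simp add: phi_square field_simps)
  have "bifib (- 2 * int m - 3) = bifib (- 2 * int m - 1) - bifib (- 2 * int m - 2)"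
    by (rule bifib_backward) simp_all
  then have "sqrt 5 * bifib (- 2 * int m - 3) = (1 / (phi * s) + phi * s) - (1 / (s * phi\<^sup>2) - s * phi\<^sup>2)"
    using Suc 1 by (simp add: s_def right_diff_distrib)
  also have "\<dots> = (1 - 1 / phi) / (phi * s) + phi * s * (1 + phi)"
    using s phi_pos by (simp add: field_simps power2_eq_square)
  also have "1 - 1 / phi = 1 / phi\<^sup>2"
    using phi_pos phi_square by (simp add: field_simps power2_eq_square)
  finally have 2: "sqrt 5 * bifib (- 2 * int m - 3) = 1 / (phi * (s * phi\<^sup>2)) + phi * (s * phi\<^sup>2)"
    by (simp add: phi_square field_simps)
  have "- 2 * int (Suc m) = - 2 * int m - 2" "- 2 * int (Suc m) - 1 = - 2 * int m - 3" by simp_all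
  then show ?case using 1 2 unfolding S by metis
qed

text \<open>The half-disks spanned by two consecutive points of contact of the disks \<open>fib_disk n\<close>
  with the line exhaust the upper half plane as \<open>n \<rightarrow> -\<infinity>\<close>.\<close>

lemma initial_gap:
  obtains m v k where "in_gap p m v k" "m > 0" "0 \<le> curv (dual v k)"
proof -
  obtain x y where p: "p = (x, y)" by (cases p)
  define K where "K = 1 - sqrt 5 * x"
  have "phi\<^sup>2 > 1" using phi_gt_1 by (simp add: phi_square)
  \<comment> \<open>For s = phi^(2 m): 2 |K| <= s keeps |K / s| <= 1/2, 20 y^2 <= s lets s^2 / 20
    absorb y^2, and the summand 1 gives s >= 1.\<close>
  then obtain m where m: "2 * \<bar>K\<bar> + 20 * y\<^sup>2 + 1 < (phi\<^sup>2) ^ m" using real_arch_pow by blast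
  define s where "s = phi ^ (2 * m)"
  have s: "s > 2 * \<bar>K\<bar> + 20 * y\<^sup>2 + 1" using m by (simp add: s_def power_mult)
  \<comment> \<open>Makes n + 1 and n + 2 the odd and even indices of \<open>bifib_negative\<close>;
    the gap lies between the line, D_(n+1) and D_(n+2).\<close>
  define n where "n = - 2 * int m - 2"
  obtain v i j k l where v: "v \<in> quads" "distinct [i, j, k, l]" and
    e: "v i = half_plane_symbol" "v j = fib_symbol n" "v k = fib_symbol (n + 1)" "v l = fib_symbol (n + 2)"
    using fib_quad[of n] by blast
  have d: "distinct [j, i, k, l]" using v(2) by auto
  \<comment> \<open>phi^n times the signed distance from \<open>x\<close> to the contact point of
    D_n; like \<open>t\<close>, it satisfies the Fibonacci recurrence.\<close>
  define G where "G n = of_int (bifib n) - phi powi n * x" for n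
  define t where "t n = phi powi n" for n :: int
  have fib: "ip (fib_symbol n) (lift p) = (G n)\<^sup>2 + (t n)\<^sup>2 * y\<^sup>2 - y" for n
  proof -
    have "phi powi (2 * n) = (t n)\<^sup>2" by (simp add: t_def power_int_mult mult.commute[of 2])
    then show ?thesis by (simp add: fib_symbol_def p G_def flip: t_def) (simp add: power2_eq_square algebra_simps)
  qed
  have t: "t (n + 2) = t (n + 1) + t n"
    using phi_pos phi_square by (simp add: t_def power_int_add algebra_simps)
  have "bifib (n + 2) = bifib (n + 1) + bifib n" using bifib_rec[of "n + 1"] by (simp add: add.commute)
  then have G: "G (n + 2) = G (n + 1) + G n" using t by (simp add: G_def algebra_simps flip: t_def)
  \<comment> \<open>Up to a positive factor, the equation of the circle having the two contact
    points as ends of a diameter.\<close>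
  have "ip (dual v j) (lift p) = G (n + 1) * G (n + 2) + t (n + 1) * t (n + 2) * y\<^sup>2"
    using dual_linear(1)[OF linear_ip d, of v "lift p"] unfolding e fib t G
    by (simp add: half_plane_symbol_def p power2_eq_square algebra_simps)
  moreover have "G (n + 1) * G (n + 2) + t (n + 1) * t (n + 2) * y\<^sup>2 \<le> 0"
  proof -
    have n: "n + 2 = - 2 * int m" "n + 1 = - 2 * int m - 1" by (simp_all add: n_def)
    have "phi powi (- 2 * int m) = 1 / s"
      using power_int_of_nat[of phi "2 * m"] by (simp add: s_def power_int_minus inverse_eq_divide)
    moreover have "phi powi (- 2 * int m - 1) = phi powi (- 2 * int m) / phi"
      using phi_pos by (simp add: power_int_diff)
    ultimately have tn: "t (n + 2) = 1 / s" "t (n + 1) = 1 / (phi * s)"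
      unfolding n t_def by simp_all
    have s1: "s \<ge> 1" using s by (smt (verit) zero_le_power2)
    have B: "sqrt 5 * bifib (n + 2) = 1 / s - s" "sqrt 5 * bifib (n + 1) = 1 / (phi * s) + phi * s"
      using bifib_negative[of m] unfolding n s_def by blast+
    have G5: "sqrt 5 * G m = sqrt 5 * bifib m - sqrt 5 * x * t m" for m
      by (simp add: G_def t_def right_diff_distrib)
    have "sqrt 5 * G (n + 2) = K / s - s"
      unfolding G5 B tn by (simp add: K_def diff_divide_distrib)
    moreover have "\<bar>K / s\<bar> \<le> 1/2"
    proof -
      have "2 * \<bar>K\<bar> \<le> s" using s zero_le_power2[of y] by linarith
      then show ?thesis using s1 by (simp add: field_simps)
    qed
    ultimately have 1: "sqrt 5 * G (n + 2) \<le> - s / 2" using s1 by linarith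
    have "sqrt 5 * G (n + 1) = K / s / phi + phi * s"
      unfolding G5 B tn by (simp add: K_def diff_divide_distrib mult.commute[of phi])
    moreover have "\<bar>K / s / phi\<bar> \<le> 1/2"
    proof -
      have "\<bar>z / phi\<bar> \<le> 1/2" if "\<bar>z\<bar> \<le> 1/2" for z
        using that phi_gt_1 phi_pos by (simp add: abs_divide field_simps)
      then show ?thesis using \<open>\<bar>K / s\<bar> \<le> 1/2\<close> by blast
    qed
    moreover have "phi * s \<ge> 1 * s" using phi_gt_1 s1 by (intro mult_right_mono) auto
    ultimately have 2: "sqrt 5 * G (n + 1) \<ge> s / 2" using s1 by linarith
    \<comment> \<open>The contact points lie on opposite sides of \<open>x\<close>, and the product
      of the distances outweighs the y^2 term.\<close>
    have "(s / 2) * (s / 2) \<le> (sqrt 5 * G (n + 1)) * (- (sqrt 5 * G (n + 2)))"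
      using 1 2 s1 by (intro mult_mono) auto
    also have "\<dots> = - 5 * (G (n + 1) * G (n + 2))" by simp
    finally have "G (n + 1) * G (n + 2) \<le> - (s * s / 20)" by simp
    moreover have "s * 1 \<le> s * s" using s1 by (intro mult_left_mono) auto
    moreover have "20 * y\<^sup>2 \<le> s" using s by linarith
    moreover have "phi * s \<ge> 1" using mult_mono[of 1 phi 1 s] phi_gt_1 s1 by simp
    then have "t (n + 1) * t (n + 2) \<le> 1 * 1"
      using s1 unfolding tn by (intro mult_mono) auto
    then have "t (n + 1) * t (n + 2) * y\<^sup>2 \<le> 1 * y\<^sup>2" by (intro mult_right_mono) auto
    ultimately show ?thesis by linarith
  qed
  ultimately have q: "ip (dual v j) (lift p) \<le> 0" by simp
  have curv_fib: "curv (fib_symbol n) = 2 * (t n)\<^sup>2" for n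
    by (simp add: fib_symbol_def t_def power_int_mult mult.commute[of 2])
  have tpos: "t n > 0" for n using phi_pos by (simp add: t_def)
  have ge: "curv (fib_symbol (n + 2)) \<ge> curv (fib_symbol (n + 1))"
    unfolding curv_fib t using tpos[of n] tpos[of "n + 1"] by (simp add: power_mono)
  have "t (n + 1) \<ge> t n"
    using phi_gt_1 tpos[of n] phi_pos by (simp add: t_def power_int_add)
  then have ge': "curv (fib_symbol (n + 1)) \<ge> curv (fib_symbol n)"
    unfolding curv_fib using tpos[of n] by (simp add: power_mono)
  have pos: "curv (fib_symbol (n + 1)) > 0" unfolding curv_fib using tpos[of "n + 1"] by simp
  have "curv (dual v j) \<ge> 0"
    using dual_linear(1)[OF linear_curv d, of v] ge ge' pos by (simp add: e half_plane_symbol_def)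
  \<comment> \<open>The bound is the smaller of the two positive curvatures at this gap.\<close>
  moreover have "in_gap p (curv (fib_symbol (n + 1))) v j"
    unfolding in_gap_def all_distinct_indices[OF v(2)] using v q ge by (simp add: e)
  ultimately show thesis using that pos by blast
qed

text \<open>Either a member contains \<open>p\<close>, or \<open>gap_descend\<close> applies
  forever: N descents give curvature at least N m, and the gap becomes smaller than
  \<open>e\<close>.\<close>

lemma member_disk_near:
  assumes "snd p > 0" "e > 0"
  obtains u z where "u \<in> members" "u \<noteq> half_plane_symbol" "Some z \<in> disk_of u" "dist p z < e"
proof (cases "\<forall>u\<in>members. ip u (lift p) > 0")
  case False
  then obtain u where u: "u \<in> members" "ip u (lift p) \<le> 0" by force
  then show thesis
  proof (cases rule: members_cases)
    case lower
    then show ?thesis using u assms by (cases p) (simp add: half_plane_symbol_def)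
  next
    case (disk c r)
    then have "Some p \<in> disk_of u" using u ip_circle_lift_le_iff by simp
    then show ?thesis using that[of u p] u(1) disk(5) assms(2) by simp
  qed
next
  case True
  obtain m v k where g: "in_gap p m v k" "m > 0" "0 \<le> curv (dual v k)" by (rule initial_gap)
  have "\<exists>v k. in_gap p m v k \<and> real N * m \<le> curv (dual v k)" for N :: nat
  proof (induction N)
    case 0
    then show ?case using g by auto
  next
    case (Suc N)
    then obtain v k where vk: "in_gap p m v k" "real N * m \<le> curv (dual v k)" by blast
    then have "0 \<le> curv (dual v k)" using g(2) by (smt (verit) mult_nonneg_nonneg of_nat_0_le_iff)
    then obtain w j where "in_gap p m w j" "curv (dual v k) + m \<le> curv (dual w j)"
      using gap_descend[OF _ vk(1) g(2)] True by blast
    then show ?case using vk by (intro exI[of _ w] exI[of _ j]) (simp add: algebra_simps)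
  qed
  moreover obtain N where N: "real N * m > 2 / e" using reals_Archimedean3[OF g(2)] by blast
  ultimately obtain w j where w: "in_gap p m w j" "2 / e < curv (dual w j)"
    by (meson less_le_trans)
  have "0 < 2 / e" using assms by simp
  then have pos: "curv (dual w j) > 0" using w by linarith
  then obtain u z where "u \<in> members" "u \<noteq> half_plane_symbol" "Some z \<in> disk_of u"
    "dist p z \<le> 2 / curv (dual w j)"
    using gap_near_member[OF w(1) g(2)] by blast
  moreover have "2 / curv (dual w j) < e" using w(2) pos assms by (simp add: field_simps)
  ultimately show thesis by (intro that[of u z]) auto
qed

lemma fib_packing_fills: "fills_upper_half_plane fib_packing"
  unfolding fills_upper_half_plane_def
proof (intro conjI ballI)
  show "pairwise (\<lambda>A B. (sphere_top interior_of A) \<inter> (sphere_top interior_of B) = {}) fib_packing"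
  proof (rule pairwiseI)
    fix A B assume "A \<in> fib_packing" "B \<in> fib_packing" "A \<noteq> B"
    then obtain u w where "u \<in> members" "w \<in> members" "u \<noteq> w" "A = disk_of u" "B = disk_of w"
      unfolding fib_packing_eq by blast
    then obtain s where "A \<inter> B \<subseteq> {s}" using members_touching by metis
    then show "(sphere_top interior_of A) \<inter> (sphere_top interior_of B) = {}" by (rule interiors_disjoint)
  qed
next
  fix A assume "A \<in> fib_packing - {lower_half_plane}"
  then obtain u where u: "u \<in> members" "A = disk_of u" "A \<noteq> lower_half_plane"
    unfolding fib_packing_eq by blast
  from u(1) show "\<exists>c r. 0 < r \<and> A = circle_disk c r \<and> cball c r \<subseteq> {(x, y). 0 \<le> y}"
  proof (cases rule: members_cases)
    case (disk c r)
    have "0 \<le> snd q" if "dist c q \<le> r" for q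
      using dist_snd_le[of c q] that disk(4) by (simp add: dist_real_def)
    then have "cball c r \<subseteq> {(x, y). 0 \<le> y}" by force
    then show ?thesis using disk u by blast
  qed (use u in simp)
next
  let ?U = "{p. Some p \<in> \<Union> (fib_packing - {lower_half_plane})}"
  have "p \<in> closure ?U" if "snd p > 0" for p
    unfolding closure_approachable
  proof (intro allI impI)
    fix e :: real assume "e > 0"
    with that obtain u z where u: "u \<in> members" "u \<noteq> half_plane_symbol" "Some z \<in> disk_of u" "dist p z < e"
      using member_disk_near by blast
    have "disk_of u \<noteq> lower_half_plane"
      using inj_onD[OF inj_on_disk_of _ u(1) half_plane_symbol_in_members] u(2) disk_of_half_plane_symbol by auto
    then have "z \<in> ?U" using u by (auto simp: fib_packing_eq)
    then show "\<exists>z\<in>?U. dist z p < e" using u(4) by (metis dist_commute)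
  qed
  then have sub: "{p. snd p > 0} \<subseteq> closure ?U" by blast
  \<comment> \<open>Points of the boundary line are limits of points above it.\<close>
  have "p \<in> closure {p :: plane. snd p > 0}" if "snd p \<ge> 0" for p :: plane
    unfolding closure_approachable
  proof (intro allI impI)
    fix e :: real assume "e > 0"
    then show "\<exists>q\<in>{p. snd p > 0}. dist q p < e"
      using that by (intro bexI[of _ "p + (0, e / 2)"]) (auto simp: dist_norm norm_Pair)
  qed
  then have "{(x, y). 0 \<le> y} \<subseteq> closure {p :: plane. snd p > 0}" by auto
  also have "\<dots> \<subseteq> closure ?U" using closure_minimal[OF sub] by simp
  finally show "{(x, y). 0 \<le> y} \<subseteq> closure ?U" .
qed

section \<open>Symbols by inversion\<close>

lemma inversion_inversion: "inversion (inversion s) = s"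
proof (cases s)
  case (Some p)
  then show ?thesis by (cases "p = 0") (simp_all add: power2_eq_square field_simps)
qed simp

lemma mem_inversion_image: "s \<in> inversion ` D \<longleftrightarrow> inversion s \<in> D"
  by (metis inversion_inversion image_iff)

lemma dist_le_iff_square: "r > 0 \<Longrightarrow> dist (a, b) (c, d) \<le> r \<longleftrightarrow> (a - c)\<^sup>2 + (b - d)\<^sup>2 \<le> r\<^sup>2" for a b :: real
  by (simp add: power2_le_iff_abs_le flip: dist_plane_square)

text \<open>Clearing the denominator |(a, b)|^2 gives the polynomial inequality that also describes
  the image. The centre has height \<open>r\<close> because the disks in question touch the
  line.\<close>

lemma inversion_disk_mem:
  fixes x r a b :: real
  assumes "r > 0" "(a, b) \<noteq> 0"
  shows "inversion (Some (a, b)) \<in> circle_disk (x, r) r \<longleftrightarrow> (a\<^sup>2 + b\<^sup>2) * x\<^sup>2 - 2 * (x * a + r * b) + 1 \<le> 0"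
proof -
  define n where "n = a\<^sup>2 + b\<^sup>2"
  have n: "n > 0" using assms(2) by (auto simp: n_def zero_prod_def sum_power2_gt_zero_iff)
  have "(norm (a, b))\<^sup>2 = n" by (simp add: n_def norm_Pair)
  then have "inversion (Some (a, b)) = Some (a / n, b / n)"
    using assms(2) n by (auto simp: divide_inverse zero_prod_def)
  then have "inversion (Some (a, b)) \<in> circle_disk (x, r) r \<longleftrightarrow> (x - a / n)\<^sup>2 + (r - b / n)\<^sup>2 \<le> r\<^sup>2"
    using assms(1) by (simp add: dist_le_iff_square)
  also have "(x - a / n)\<^sup>2 + (r - b / n)\<^sup>2 = x\<^sup>2 + r\<^sup>2 - 2 * (x * a + r * b) / n + (a\<^sup>2 + b\<^sup>2) / n / n"
    using n by (simp add: field_simps power2_eq_square)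
  also have "(a\<^sup>2 + b\<^sup>2) / n = 1" using n by (simp flip: n_def)
  also have "x\<^sup>2 + r\<^sup>2 - 2 * (x * a + r * b) / n + 1 / n \<le> r\<^sup>2 \<longleftrightarrow> n * x\<^sup>2 - 2 * (x * a + r * b) + 1 \<le> 0"
    using n by (simp add: field_simps)
  finally show ?thesis by (simp add: n_def)
qed

text \<open>The origin has power x^2 with respect to the circle, so for nonzero x the image has
  radius r / x^2 and touches the line at 1 / x. For x = 0 the circle passes through the origin and
  the image is the half-plane y >= 1 / (2 r).\<close>

lemma inversion_tangent_disk:
  assumes "r > 0"
  shows "has_curvature (inversion ` circle_disk (x, r) r) (x\<^sup>2 / r)"
proof (cases "x = 0")
  case True
  have "inversion ` circle_disk (x, r) r = half_plane (0, -1) (- 1 / (2 * r))"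
  proof (rule set_eqI)
    fix s
    show "s \<in> inversion ` circle_disk (x, r) r \<longleftrightarrow> s \<in> half_plane (0, -1) (- 1 / (2 * r))"
    proof (cases s)
      case None
      have "dist (x, r) (0, 0) \<le> r" using True assms by (subst dist_le_iff_square) auto
      then show ?thesis using assms None by (simp add: mem_inversion_image zero_prod_def)
    next
      case (Some q)
      show ?thesis
      proof (cases "q = 0")
        case True
        then show ?thesis using assms Some by (simp add: mem_inversion_image)
      next
        case False
        then show ?thesis
          using assms Some True inversion_disk_mem[of r "fst q" "snd q" x]
          by (cases q) (simp add: mem_inversion_image field_simps del: inversion.simps)
      qed
    qed
  qed
  then show ?thesis using True has_curvature.line[of "(0, -1)"] by (simp add: norm_Pair)
next
  case False
  then have x: "x\<^sup>2 > 0" by simp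
  have rx: "r / x\<^sup>2 > 0" using assms x by simp
  have mem: "Some (a, b) \<in> circle_disk (1 / x, r / x\<^sup>2) (r / x\<^sup>2) \<longleftrightarrow>
      (a\<^sup>2 + b\<^sup>2) * x\<^sup>2 - 2 * (x * a + r * b) + 1 \<le> 0" for a b
  proof -
    have "Some (a, b) \<in> circle_disk (1 / x, r / x\<^sup>2) (r / x\<^sup>2) \<longleftrightarrow>
        ((1 / x - a)\<^sup>2 + (r / x\<^sup>2 - b)\<^sup>2 - (r / x\<^sup>2)\<^sup>2) * x\<^sup>2 \<le> 0"
      using rx x by (simp add: dist_le_iff_square mult_le_0_iff)
    also have "((1 / x - a)\<^sup>2 + (r / x\<^sup>2 - b)\<^sup>2 - (r / x\<^sup>2)\<^sup>2) * x\<^sup>2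
        = (a\<^sup>2 + b\<^sup>2) * x\<^sup>2 - 2 * (x * a + r * b) + 1"
      using False by (simp add: field_simps power2_eq_square)
    finally show ?thesis .
  qed
  have "inversion ` circle_disk (x, r) r = circle_disk (1 / x, r / x\<^sup>2) (r / x\<^sup>2)"
  proof (rule set_eqI)
    fix s
    show "s \<in> inversion ` circle_disk (x, r) r \<longleftrightarrow> s \<in> circle_disk (1 / x, r / x\<^sup>2) (r / x\<^sup>2)"
    proof (cases s)
      case None
      have "\<not> dist (x, r) (0, 0) \<le> r" using False assms by (subst dist_le_iff_square) auto
      then show ?thesis using assms x rx None by (simp add: mem_inversion_image zero_prod_def)
    next
      case (Some q)
      show ?thesis
      proof (cases "q = 0")
        case True
        then show ?thesis
          using assms Some mem[of 0 0] by (simp add: mem_inversion_image zero_prod_def del: mem_disks(1))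
      next
        case False
        then show ?thesis
          using assms Some inversion_disk_mem[of r "fst q" "snd q" x] mem[of "fst q" "snd q"]
          by (simp add: mem_inversion_image del: inversion.simps mem_disks(1))
      qed
    qed
  qed
  then show ?thesis
    using has_curvature.circle[of "r / x\<^sup>2" "(1 / x, r / x\<^sup>2)"] assms False by simp
qed

lemma inversion_lower_half_plane: "inversion ` lower_half_plane = lower_half_plane"
proof (rule set_eqI)
  fix s
  show "s \<in> inversion ` lower_half_plane \<longleftrightarrow> s \<in> lower_half_plane"
  proof (cases s)
    case (Some q)
    then show ?thesis
      by (cases q; cases "q = 0")
        (auto simp: mem_inversion_image lower_half_plane_eq zero_prod_def mult_le_0_iff)
  qed (simp add: mem_inversion_image lower_half_plane_eq)
qed

lemma has_symbol_lower_half_plane_iff: "has_symbol E (0, -1, 0, 0) \<longleftrightarrow> E = lower_half_plane"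
proof
  assume "has_symbol E (0, -1, 0, 0)"
  then show "E = lower_half_plane"
  proof cases
    case (line u v b)
    then have E: "E = half_plane (0, 1) b" and cur: "has_curvature (inversion ` half_plane (0, 1) b) 0"
      by auto
    from cur obtain a d where a: "norm a = 1" and I: "inversion ` half_plane (0, 1) b = half_plane a d"
      by cases auto
    \<comment> \<open>The image is a half-plane and contains infinity, so the original contains the
      origin.\<close>
    have "inversion None \<in> half_plane (0, 1) b"
      unfolding mem_inversion_image[symmetric] I by simp
    then have b: "b \<ge> 0" by simp
    have "b = 0"
    proof (rule ccontr)
      assume "b \<noteq> 0"
      with b have b: "b > 0" by simp
      \<comment> \<open>The point t a lies outside the image because t > d, yet its inverse a / t
        has norm at most b and so lies in y <= b.\<close>
      define t where "t = max (1 / b) (d + 1)"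
      have t: "t \<ge> 1 / b" "t > d" by (auto simp: t_def)
      have t0: "t > 0" using t(1) b by (smt (verit) zero_less_divide_1_iff)
      have at: "a \<bullet> (t *\<^sub>R a) = t" using a by (simp add: norm_eq_1)
      have "Some (t *\<^sub>R a) \<notin> half_plane a d" unfolding mem_disks at using t by simp
      moreover have "inversion (Some (t *\<^sub>R a)) \<in> half_plane (0, 1) b"
      proof -
        have "a \<noteq> 0" using a by auto
        then have "inversion (Some (t *\<^sub>R a)) = Some ((1 / t) *\<^sub>R a)"
          using a t0 by (simp add: power2_eq_square field_simps)
        moreover have "(0, 1) \<bullet> ((1 / t) *\<^sub>R a) \<le> 1 / t"
          using norm_snd_le[of "snd a" "fst a"] a t0 by (simp add: inner_prod_def divide_right_mono)
        moreover have "1 / t \<le> b" using t(1) t0 b by (simp add: field_simps)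
        ultimately show ?thesis by simp
      qed
      ultimately show False unfolding I[symmetric] mem_inversion_image by simp
    qed
    then show ?thesis using E by (simp add: lower_half_plane_eq)
  qed simp
next
  have "has_curvature (inversion ` lower_half_plane) 0"
    unfolding inversion_lower_half_plane
    unfolding lower_half_plane_eq by (rule has_curvature.line) (simp add: norm_Pair)
  then show "E = lower_half_plane \<Longrightarrow> has_symbol E (0, -1, 0, 0)"
    using has_symbol.line[of 0 1 0 0] by (simp add: lower_half_plane_eq norm_Pair)
qed

lemma has_symbol_fib_disk_iff: "has_symbol E (fib_symbol n) \<longleftrightarrow> E = fib_disk n"
proof -
  define t where "t = phi powi n"
  have t: "t > 0" using phi_pos by (simp add: t_def)
  have e: "phi powi (2 * n) = t\<^sup>2" "phi powi (- n) = 1 / t" "phi powi (- 2 * n) = 1 / t\<^sup>2"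
    by (simp_all add: t_def power_int_minus power_int_mult mult.commute[of 2] inverse_eq_divide)
  \<comment> \<open>Radius \<open>r\<close> and contact point \<open>x\<close> put the symbol in the
    form (x / r, 1, 1 / r, x^2 / r) matching \<open>inversion_tangent_disk\<close>.\<close>
  define r where "r = 1 / (2 * t\<^sup>2)"
  define x where "x = of_int (bifib n) / t"
  have r: "r > 0" using t by (simp add: r_def)
  have D: "fib_disk n = circle_disk (x, r) r"
    unfolding fib_disk_def e x_def r_def by (simp add: mult.commute)
  have S: "fib_symbol n = (x / r, 1, 1 / r, x\<^sup>2 / r)"
    using t unfolding fib_symbol_def e(1) t_def[symmetric]
    by (simp add: x_def r_def field_simps power2_eq_square)
  show ?thesis
    unfolding S D
  proof
    assume "has_symbol E (x / r, 1, 1 / r, x\<^sup>2 / r)"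
    then show "E = circle_disk (x, r) r" by cases (use r in auto)
  next
    assume "E = circle_disk (x, r) r"
    then show "has_symbol E (x / r, 1, 1 / r, x\<^sup>2 / r)"
      using has_symbol.circle[OF _ inversion_tangent_disk[OF r], of x] r by simp
  qed
qed

text \<open>D_(-m) has radius phi^(2 m) / 2.\<close>

lemma fib_packing_unbounded: "\<exists>c r. r > R \<and> r > 0 \<and> circle_disk c r \<in> fib_packing"
proof -
  have "phi\<^sup>2 > 1" using phi_gt_1 by (simp add: phi_square)
  then obtain m where m: "2 * R < (phi\<^sup>2) ^ m" using real_arch_pow by blast
  have "phi powi (- 2 * - int m) = (phi\<^sup>2) ^ m"
    using power_int_of_nat[of phi "2 * m"] by (simp add: power_mult)
  moreover have "fib_disk (- int m) \<in> fib_packing"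
    using fib_symbol_in_members disk_of_fib_symbol by (metis fib_packing_eq image_eqI)
  moreover have "(phi\<^sup>2) ^ m > 0" using phi_pos by simp
  ultimately show ?thesis
    unfolding fib_disk_def using m by (metis half_gt_zero less_divide_eq_numeral1(1) mult.commute)
qed

theorem proposition1:
  shows
    "(\<forall>E. has_symbol E (0, -1, 0, 0) \<longleftrightarrow> E = lower_half_plane) \<and>
     (\<forall>n E. has_symbol E (2 * of_int (bifib n) * phi powi n, 1,
                          2 * phi powi (2 * n), 2 * (of_int (bifib n))\<^sup>2)
              \<longleftrightarrow> E = fib_disk n) \<and>
     (\<forall>n. descartes_configuration
            {lower_half_plane, fib_disk n, fib_disk (n + 1), fib_disk (n + 2)}) \<and>
     (\<exists>P. apollonian_packing P \<and>
          lower_half_plane \<in> P \<and> (\<forall>n. fib_disk n \<in> P) \<and>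
          fills_upper_half_plane P \<and>
          (\<forall>R. \<exists>c r. r > R \<and> r > 0 \<and> circle_disk c r \<in> P) \<and>
          has_symbol lower_half_plane (0, -1, 0, 0) \<and>
          has_symbol (fib_disk 0) (0, 1, 2, 0) \<and>
          has_symbol (fib_disk 1) (2 * phi, 1, 2 * phi\<^sup>2, 2) \<and>
          is_seed_of {lower_half_plane, fib_disk 0, fib_disk 1} P)"
proof (intro conjI allI exI[of _ fib_packing])
  show seed: "is_seed_of {lower_half_plane, fib_disk 0, fib_disk 1} fib_packing"
    using fib_seed by (simp add: is_seed_of_def fib_packing_def)
  then show "apollonian_packing fib_packing" unfolding apollonian_packing_def by blast
  show "lower_half_plane \<in> fib_packing"
    using half_plane_symbol_in_members disk_of_half_plane_symbol by (metis fib_packing_eq image_eqI)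
  show "fib_disk n \<in> fib_packing" for n
    using fib_symbol_in_members disk_of_fib_symbol by (metis fib_packing_eq image_eqI)
  show "has_symbol E (2 * of_int (bifib n) * phi powi n, 1,
      2 * phi powi (2 * n), 2 * (of_int (bifib n))\<^sup>2) \<longleftrightarrow> E = fib_disk n" for n E
    using has_symbol_fib_disk_iff[of E n] by (simp add: fib_symbol_def)
  show "has_symbol (fib_disk 0) (0, 1, 2, 0)" "has_symbol (fib_disk 1) (2 * phi, 1, 2 * phi\<^sup>2, 2)"
    using has_symbol_fib_disk_iff[of _ 0] has_symbol_fib_disk_iff[of _ 1]
    by (simp_all add: fib_symbol_0 fib_symbol_1)
qed (use has_symbol_lower_half_plane_iff fib_descartes_configuration fib_packing_fills
    fib_packing_unbounded in blast)+

end
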